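(* Let $d\ge 5$, and let $l_\infty$ and $\tilde l_\infty$ be the infinite-time local times of two independent aperiodic simple random walks on $\mathbb{Z}^d$, both started at $0$. For $\xi>0$ set $\mathcal{D}(\xi)=\{z\in\mathbb{Z}^d:\ l_\infty(z)\ge\xi\}$ and $\tilde{\mathcal{D}}(\xi)=\{z\in\mathbb{Z}^d:\ \tilde l_\infty(z)\ge\xi\}$. Then $$\limsup_{A\to\infty}\ \limsup_{t\to\infty}\ \frac{1}{\sqrt t}\log\mathbb{P}\Bigg(\sum_{z\notin \mathcal{D}(\sqrt t/A)\cap\tilde{\mathcal{D}}(\sqrt t/A)} l_\infty(z)\,\tilde l_\infty(z)>t\Bigg)=-\infty.$$
   Context: The aperiodic simple random walk on $\mathbb{Z}^d$ is the Markov chain for which, given $S_n$, the position $S_{n+1}$ is uniform on the $2d+1$ sites $\{z\in\mathbb{Z}^d:\ |z-S_n|\le 1\}$, where $|z|=|z_1|+\dots+|z_d|$. $(S_n)$ and $(\tilde S_n)$ are two independent such walks started at $0$, and $\mathbb{P}=P_0\otimes\tilde P_0$ is their joint law. Local times: $l_\infty(z)=\sum_{k=0}^\infty\mathbf{1}\{S_k=z\}$ and $\tilde l_\infty(z)=\sum_{k=0}^\infty\mathbf{1}\{\tilde S_k=z\}$. *)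

theory Defs
  imports "HOL-Probability.Probability"
begin

definition norm_l1 :: "int ^ 'd \<Rightarrow> int"
  where "norm_l1 z = (\<Sum>i\<in>UNIV. \<bar>z $ i\<bar>)"

definition sites :: "int ^ 'd \<Rightarrow> (int ^ 'd) set"
  where "sites x = {z. norm_l1 (z - x) \<le> 1}"

text \<open>\<open>pmf_of_set\<close> is the uniform distribution only on finite nonempty sets.\<close>

lemma sites_eq:
  "sites x = insert x ((\<lambda>(i, s). x + axis i s) ` (UNIV \<times> {1, -1}))"
proof (intro equalityI subsetI)
  fix z assume "z \<in> sites x"
  then have le: "(\<Sum>i\<in>UNIV. \<bar>(z - x) $ i\<bar>) \<le> 1"
    by (simp add: sites_def norm_l1_def)
  show "z \<in> insert x ((\<lambda>(i, s). x + axis i s) ` (UNIV \<times> {1, -1}))"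
  proof (cases "z = x")
    case False
    then obtain i where i: "(z - x) $ i \<noteq> 0"
      by (auto simp: vec_eq_iff)
    have split: "(\<Sum>j\<in>UNIV. \<bar>(z - x) $ j\<bar>)
        = \<bar>(z - x) $ i\<bar> + (\<Sum>j\<in>UNIV - {i}. \<bar>(z - x) $ j\<bar>)"
      by (rule sum.remove) auto
    have nonneg: "(\<Sum>j\<in>UNIV - {i}. \<bar>(z - x) $ j\<bar>) \<ge> 0"
      by (rule sum_nonneg) auto
    have one: "\<bar>(z - x) $ i\<bar> = 1"
      using le split nonneg i by linarith
    then have "(\<Sum>j\<in>UNIV - {i}. \<bar>(z - x) $ j\<bar>) = 0"
      using le split nonneg by linarith
    then have zero: "(z - x) $ j = 0" if "j \<noteq> i" for j
      using that by (subst (asm) sum_nonneg_eq_0_iff) auto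
    have "z = x + axis i ((z - x) $ i)"
      using zero by (auto simp: vec_eq_iff axis_def)
    moreover have "(z - x) $ i \<in> {1, -1}"
      using one by (auto simp: abs_if split: if_splits)
    ultimately show ?thesis by (metis (no_types, lifting) SigmaI UNIV_I case_prod_conv imageI insertI2)
  qed simp
next
  fix z assume "z \<in> insert x ((\<lambda>(i, s). x + axis i s) ` (UNIV \<times> {1, -1}))"
  then consider "z = x" | i s where "z = x + axis i s" "s \<in> {1, -1::int}"
    by auto
  then show "z \<in> sites x"
  proof cases
    case (2 i s)
    have "norm_l1 (z - x) = (\<Sum>j\<in>UNIV. if j = i then \<bar>s\<bar> else 0)"
      unfolding norm_l1_def 2 by (rule sum.cong) (auto simp: axis_def)
    then show ?thesis using 2(2) by (auto simp: sites_def)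
  qed (simp add: sites_def norm_l1_def)
qed

lemma finite_sites: "finite (sites x)"
  by (simp add: sites_eq)

lemma sites_nonempty: "sites x \<noteq> {}"
  by (simp add: sites_eq)

lemma card_sites: "card (sites (x :: int ^ 'd)) = 2 * CARD('d) + 1"
proof -
  let ?f = "\<lambda>(i, s). x + axis i (s::int)"
  have inj: "inj_on ?f (UNIV \<times> {1, -1})"
    by (auto simp: inj_on_def axis_eq_axis)
  have "x \<notin> ?f ` (UNIV \<times> {1, -1})"
    by (auto simp: axis_eq_0_iff)
  moreover have "card (?f ` (UNIV \<times> {1, -1})) = 2 * CARD('d)"
    by (subst card_image[OF inj]) (simp add: card_cartesian_product)
  ultimately show ?thesis
    by (simp add: sites_eq)
qed

text \<open>The Markov property is stated for all pasts of positive probability, which determines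
  the law of the whole path.\<close>

definition aperiodic_srw :: "'a measure \<Rightarrow> int ^ 'd \<Rightarrow> (nat \<Rightarrow> 'a \<Rightarrow> int ^ 'd) \<Rightarrow> bool"
  where "aperiodic_srw M x S \<longleftrightarrow>
    prob_space M \<and>
    (\<forall>n. S n \<in> measurable M (count_space UNIV)) \<and>
    (AE \<omega> in M. S 0 \<omega> = x) \<and>
    (\<forall>n p y. \<P>(\<omega> in M. \<forall>k\<le>n. S k \<omega> = p k) > 0 \<longrightarrow>
      \<P>(\<omega> in M. S (Suc n) \<omega> = y \<bar> \<forall>k\<le>n. S k \<omega> = p k) = pmf (pmf_of_set (sites (p n))) y)"

definition independent_walks ::
    "'a measure \<Rightarrow> (nat \<Rightarrow> 'a \<Rightarrow> int ^ 'd) \<Rightarrow> (nat \<Rightarrow> 'a \<Rightarrow> int ^ 'd) \<Rightarrow> bool"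
  where "independent_walks M S S' \<longleftrightarrow>
    prob_space.indep_var M
      (\<Pi>\<^sub>M n\<in>UNIV. count_space UNIV) (\<lambda>\<omega> n. S n \<omega>)
      (\<Pi>\<^sub>M n\<in>UNIV. count_space UNIV) (\<lambda>\<omega> n. S' n \<omega>)"

definition local_time :: "(nat \<Rightarrow> 'a \<Rightarrow> int ^ 'd) \<Rightarrow> 'a \<Rightarrow> int ^ 'd \<Rightarrow> ennreal"
  where "local_time S \<omega> z = (\<Sum>k. indicator {k. S k \<omega> = z} k)"

definition level_set :: "(nat \<Rightarrow> 'a \<Rightarrow> int ^ 'd) \<Rightarrow> 'a \<Rightarrow> real \<Rightarrow> (int ^ 'd) set"
  where "level_set S \<omega> \<xi> = {z. local_time S \<omega> z \<ge> ennreal \<xi>}"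

text \<open>The library's \<open>ln\<close> on the reals has \<open>ln 0 = 0\<close>; probabilities need \<open>log 0 = -\<infinity>\<close>.\<close>

definition log_prob :: "real \<Rightarrow> ereal"
  where "log_prob p = (if p = 0 then -\<infinity> else ereal (ln p))"

end

theory Submission
  imports Defs
begin

text \<open>
  If a site outside both level sets is met, one of the walks visits it fewer than \<open>\<xi> = sqrt t / A\<close>
  times, so it suffices to bound the additive functional of one walk given by the local time \<open>f\<close> of the
  other walk, truncated at level \<open>\<xi>\<close>. If the potential \<open>G f\<close> is at most \<open>L = sqrt t / B\<close> along the
  path, an exponential supermartingale shows that the functional exceeds \<open>t / 2\<close> with probability
  at most \<open>2 exp (- B sqrt t / 4)\<close>. Write the Green function as a sum of the transition kernels
  \<open>p\<^sub>k\<close>. The part \<open>k < N\<close> contributes at most \<open>N \<xi>\<close> to \<open>G f\<close>, which is small compared with \<open>L\<close> for large \<open>A\<close>.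
  The part \<open>k \<ge> N\<close> is an additive functional of the other walk with potential \<open>\<Sum>k. (k + 1) p\<^sub>k\<^sub>+\<^sub>N\<close>.
  In dimension at least five \<open>p\<^sub>k = O(k powr (-5/2))\<close>, so this potential is uniformly small for large
  \<open>N\<close>, and the same supermartingale bound applies with an arbitrarily large rate.
\<close>

subsection \<open>Decay of the transition kernel\<close>

text \<open>Passing from \<open>k\<close> to \<open>k + 1\<close> multiplies the coefficient by
  \<open>2 (2k + 1) / (k + 1)\<close>. Together with
  \<open>sqrt ((2k + 1) (2k + 3)) \<le> 2 (k + 1)\<close>, the inequality of the means, this is a
  factor of at most 4 overall.\<close>

lemma central_binomial_le: "real (2 * k choose k) * sqrt (2 * k + 1) \<le> 4 ^ k"
proof (induction k)
  case (Suc k)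
  let ?c = "real (2 * k choose k)"
  have "Suc k * (2 * Suc k choose Suc k) = 2 * (2 * k + 1) * (2 * k choose k)"
  proof -
    have "Suc k * (2 * Suc k choose Suc k) = (2 * Suc k) * (2 * k + 1 choose k)"
      using binomial_absorption[of k "2 * Suc k"] by simp
    moreover have "Suc k * (2 * k + 1 choose k) = (2 * k + 1) * (2 * k choose k)"
      using binomial_absorb_comp[of "2 * k + 1" k] by (simp add: Suc_diff_le del: binomial_Suc_Suc)
    moreover have "(2 * Suc k) * c = 2 * (Suc k * c)" for c
      by simp
    ultimately show ?thesis
      by (metis mult.assoc)
  qed
  then have "real (Suc k * (2 * Suc k choose Suc k)) = real (2 * (2 * k + 1) * (2 * k choose k))"
    by (rule arg_cong)
  then have rec: "real (2 * Suc k choose Suc k) = 2 * (2 * real k + 1) / (k + 1) * ?c"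
    by (simp add: field_simps del: binomial_Suc_Suc)
  have root: "sqrt (2 * real k + 1) * sqrt (2 * real k + 3) \<le> 2 * (real k + 1)"
    unfolding real_sqrt_mult[symmetric]
    by (rule real_le_lsqrt) (auto simp: power2_eq_square algebra_simps)
  have "real (2 * Suc k choose Suc k) * sqrt (2 * Suc k + 1)
      = 2 / (k + 1) * (?c * sqrt (2 * k + 1)) * (sqrt (2 * real k + 1) * sqrt (2 * real k + 3))"
  proof -
    have e: "sqrt (real (2 * Suc k + 1)) = sqrt (2 * real k + 3)" "sqrt (real (2 * k + 1)) = sqrt (2 * real k + 1)"
      by (simp_all add: add.commute)
    have "sqrt (2 * real k + 1) * sqrt (2 * real k + 1) = 2 * real k + 1"
      by simp
    then have "c * sqrt (2 * real k + 1) * (sqrt (2 * real k + 1) * r) = (2 * real k + 1) * c * r" for c r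
      by (metis mult.assoc mult.commute)
    then have "2 / (k + 1) * (?c * sqrt (2 * real k + 1)) * (sqrt (2 * real k + 1) * sqrt (2 * real k + 3))
      = 2 / (k + 1) * ((2 * real k + 1) * ?c * sqrt (2 * real k + 3))"
      by (simp only: mult.assoc)
    then show ?thesis
      unfolding rec e by (simp add: mult_ac)
  qed
  also have "\<dots> \<le> 2 / (k + 1) * 4 ^ k * (2 * (real k + 1))"
    by (intro mult_mono[OF mult_left_mono[OF Suc] root]) auto
  also have "\<dots> = 4 ^ Suc k"
    by (simp add: field_simps)
  finally show ?case .
qed simp

text \<open>For \<open>m = 2k + 1\<close> the two middle coefficients coincide, so each is half of
  the central coefficient of order \<open>2k + 2\<close>.\<close>

lemma middle_binomial_le: "real (m choose (m div 2)) * sqrt (m + 1) \<le> 2 ^ m"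
proof (cases "even m")
  case True
  then obtain k where "m = 2 * k" by blast
  then show ?thesis
    using central_binomial_le[of k] by (simp add: power_mult)
next
  case False
  then obtain k where m: "m = 2 * k + 1" by (metis oddE)
  have "(m choose Suc k) = (m choose k)"
    unfolding m using binomial_symmetric[of k "2 * k + 1"] by (simp add: Suc_diff_le)
  moreover have "2 * Suc k = Suc m" by (simp add: m)
  ultimately have "(2 * Suc k choose Suc k) = 2 * (m choose k)"
    by (simp only: binomial_Suc_Suc)
  then have "real (2 * Suc k choose Suc k) = 2 * real (m choose k)"
    by linarith
  then have "real (m choose k) * sqrt (m + 2) \<le> 2 ^ m"
    using central_binomial_le[of "Suc k"] by (simp add: m power_mult mult.assoc add.commute del: binomial_Suc_Suc)
  moreover have "real (m choose k) * sqrt (m + 1) \<le> real (m choose k) * sqrt (m + 2)"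
    by (intro mult_left_mono) auto
  moreover have "m div 2 = k" by (simp add: m)
  ultimately show ?thesis
    by (metis order.trans)
qed

section \<open>Counting lattice paths one coordinate at a time\<close>

text \<open>Counts the paths with \<open>m\<close> steps of size exactly one that lead from
  \<open>j\<close> to 0 on the integers. Holding steps are left to \<open>paths_along\<close>, so
  that inserting a coordinate does not count them twice.\<close>

primrec line_paths :: "nat \<Rightarrow> int \<Rightarrow> real"
  where "line_paths 0 j = of_bool (j = 0)"
  | "line_paths (Suc m) j = line_paths m (j + 1) + line_paths m (j - 1)"

text \<open>A path from \<open>j\<close> to 0 has exactly \<open>(j + m) / 2\<close> downward steps
  among its \<open>m\<close> steps; the binomial coefficient chooses their places.\<close>

lemma line_paths_eq:
  "line_paths m j = (if even (j + int m) \<and> j + int m \<ge> 0 then m choose nat ((j + int m) div 2) else 0)"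
proof (induction m arbitrary: j)
  case (Suc m)
  \<comment> \<open>Only the last case is Pascal's rule. At \<open>j + Suc m = 0\<close> one of the
    two summands lies outside the support, so it is kept apart.\<close>
  consider "odd (j + int (Suc m))" | "even (j + int (Suc m))" "j + int (Suc m) < 0"
    | "j + int (Suc m) = 0" | k where "j + int (Suc m) = 2 * int (Suc k)"
  proof -
    assume *: "odd (j + int (Suc m)) \<Longrightarrow> thesis" "even (j + int (Suc m)) \<Longrightarrow> j + int (Suc m) < 0 \<Longrightarrow> thesis"
      "j + int (Suc m) = 0 \<Longrightarrow> thesis" "\<And>k. j + int (Suc m) = 2 * int (Suc k) \<Longrightarrow> thesis"
    show thesis
    proof (cases "even (j + int (Suc m)) \<and> j + int (Suc m) > 0")
      case True
      then obtain r where r: "j + int (Suc m) = 2 * r" "r > 0" by (elim conjE evenE) auto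
      then have "r = int (Suc (nat (r - 1)))" by auto
      then show ?thesis using * r by metis
    next
      case False
      then show ?thesis using * by fastforce
    qed
  qed
  then show ?case
  proof cases
    case (4 k)
    have e: "j + 1 + int m = 2 * int (Suc k)" "j - 1 + int m = 2 * int k"
      using 4 by auto
    show ?thesis
      unfolding line_paths.simps Suc.IH e 4 by (simp del: of_nat_Suc)
  next
    case 3
    then have e: "j + 1 + int m = 0" "j - 1 + int m = - 2" by auto
    show ?thesis unfolding line_paths.simps Suc.IH e 3 by simp
  next
    case 2
    then have "j + 1 + int m < 0" "j - 1 + int m < 0" by auto
    then show ?thesis using 2 unfolding line_paths.simps Suc.IH by simp
  next
    case 1
    then have "odd (j + 1 + int m)" "odd (j - 1 + int m)" by auto
    then show ?thesis using 1 unfolding line_paths.simps Suc.IH by simp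
  qed
qed auto

lemma line_paths_nonneg: "0 \<le> line_paths m j"
  by (simp add: line_paths_eq)

lemma line_paths_le: "line_paths m j \<le> 2 ^ m / sqrt (m + 1)"
proof -
  have "line_paths m j \<le> m choose (m div 2)"
    by (auto simp: line_paths_eq binomial_maximum)
  also have "\<dots> \<le> 2 ^ m / sqrt (m + 1)"
    using middle_binomial_le[of m] by (simp add: field_simps)
  finally show ?thesis .
qed

text \<open>Counts the paths from \<open>x\<close> to 0 that in each of \<open>n\<close> steps stay
  put or move one unit along a coordinate in \<open>I\<close>. The parameter \<open>I\<close>
  permits induction on the set of coordinates.\<close>

primrec paths_along :: "'d set \<Rightarrow> nat \<Rightarrow> int ^ 'd \<Rightarrow> real"
  where "paths_along I 0 x = of_bool (x = 0)"
  | "paths_along I (Suc n) x =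
      paths_along I n x + (\<Sum>i\<in>I. paths_along I n (x + axis i 1) + paths_along I n (x + axis i (- 1)))"

lemma paths_along_nonneg: "0 \<le> paths_along I n x"
  by (induction n arbitrary: x) (auto intro!: add_nonneg_nonneg sum_nonneg)

text \<open>A Leibniz rule for binomial convolutions: Pascal's rule splits by whether the extra step
  advances \<open>a\<close> or \<open>b\<close>.\<close>

lemma sum_Suc_choose_convolution:
  fixes a b :: "nat \<Rightarrow> real"
  shows "(\<Sum>m\<le>Suc n. (Suc n choose m) * a m * b (Suc n - m))
    = (\<Sum>m\<le>n. (n choose m) * (a (Suc m) * b (n - m) + a m * b (Suc (n - m))))"
proof -
  have "(\<Sum>m\<le>Suc n. (Suc n choose m) * a m * b (Suc n - m))
      = a 0 * b (Suc n) + (\<Sum>m\<le>n. (Suc n choose Suc m) * a (Suc m) * b (n - m))"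
    by (subst sum.atMost_Suc_shift) simp
  also have "(\<Sum>m\<le>n. (Suc n choose Suc m) * a (Suc m) * b (n - m))
      = (\<Sum>m\<le>n. (n choose m) * (a (Suc m) * b (n - m))) + (\<Sum>m\<le>n. (n choose Suc m) * a (Suc m) * b (n - m))"
    by (simp add: sum.distrib[symmetric] algebra_simps)
  also have "a 0 * b (Suc n) + (\<dots>) = (\<Sum>m\<le>n. (n choose m) * (a (Suc m) * b (n - m)))
      + (\<Sum>m\<le>Suc n. (n choose m) * a m * b (Suc n - m))"
    by (subst sum.atMost_Suc_shift) (simp del: sum.atMost_Suc)
  also have "(\<Sum>m\<le>Suc n. (n choose m) * a m * b (Suc n - m)) = (\<Sum>m\<le>n. (n choose m) * (a m * b (Suc (n - m))))"
    by (simp add: Suc_diff_le mult.assoc)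
  finally show ?thesis
    by (simp add: sum.distrib algebra_simps)
qed

text \<open>Choose which \<open>m\<close> of the \<open>n\<close> steps go along \<open>i\<close>.
  The others, holding steps included, form a path along \<open>I\<close> from the point whose
  \<open>i\<close>-th coordinate is erased.\<close>

lemma paths_along_insert:
  fixes x :: "int ^ 'd"
  assumes i: "i \<notin> I"
  shows "paths_along (insert i I) n x
    = (\<Sum>m\<le>n. (n choose m) * line_paths m (x $ i) * paths_along I (n - m) (\<chi> k. if k = i then 0 else x $ k))"
proof (induction n arbitrary: x)
  case 0
  have "x = 0 \<longleftrightarrow> x $ i = 0 \<and> (\<chi> k. if k = i then 0 else x $ k) = 0"
    by (auto simp: vec_eq_iff)
  then show ?case by auto
next
  case (Suc n)
  let ?p = "\<lambda>x::int ^ 'd. \<chi> k. if k = i then 0 else x $ k"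
  let ?a = "\<lambda>j m. line_paths m j" and ?b = "\<lambda>y m. paths_along I m y"
  have same: "?p (x + axis i s) = ?p x" "(x + axis i s) $ i = x $ i + s" for s
    by (auto simp: vec_eq_iff axis_def)
  have other: "?p (x + axis k s) = ?p x + axis k s" "(x + axis k s) $ i = x $ i" "axis k s $ i = 0" if "k \<in> I" for k s
    using that i by (auto simp: vec_eq_iff axis_def)
  have "paths_along (insert i I) (Suc n) x
      = (paths_along (insert i I) n (x + axis i 1) + paths_along (insert i I) n (x + axis i (- 1)))
       + (paths_along (insert i I) n x +
        (\<Sum>k\<in>I. paths_along (insert i I) n (x + axis k 1) + paths_along (insert i I) n (x + axis k (- 1))))"
    using i by simp
  also have "\<dots> = (\<Sum>m\<le>n. (n choose m) * line_paths (Suc m) (x $ i) * ?b (?p x) (n - m))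
     + (\<Sum>m\<le>n. (n choose m) * line_paths m (x $ i) * ?b (?p x) (Suc (n - m)))"
  proof (rule arg_cong2[where f = "(+)"])
    show "paths_along (insert i I) n (x + axis i 1) + paths_along (insert i I) n (x + axis i (- 1))
      = (\<Sum>m\<le>n. (n choose m) * line_paths (Suc m) (x $ i) * ?b (?p x) (n - m))"
      unfolding Suc.IH same by (simp add: sum.distrib[symmetric] algebra_simps)
    have "(\<Sum>k\<in>I. paths_along (insert i I) n (x + axis k 1) + paths_along (insert i I) n (x + axis k (- 1)))
      = (\<Sum>k\<in>I. \<Sum>m\<le>n. (n choose m) * line_paths m (x $ i) *
          (?b (?p x + axis k 1) (n - m) + ?b (?p x + axis k (- 1)) (n - m)))"
      unfolding Suc.IH sum.distrib[symmetric] by (intro sum.cong refl) (simp add: other distrib_left)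
    also have "\<dots> = (\<Sum>m\<le>n. (n choose m) * line_paths m (x $ i) *
        (\<Sum>k\<in>I. ?b (?p x + axis k 1) (n - m) + ?b (?p x + axis k (- 1)) (n - m)))"
      by (subst sum.swap) (simp add: sum_distrib_left)
    finally show "paths_along (insert i I) n x +
        (\<Sum>k\<in>I. paths_along (insert i I) n (x + axis k 1) + paths_along (insert i I) n (x + axis k (- 1)))
      = (\<Sum>m\<le>n. (n choose m) * line_paths m (x $ i) * ?b (?p x) (Suc (n - m)))"
      unfolding Suc.IH[of x] by (simp add: sum.distrib[symmetric] algebra_simps)
  qed
  also have "\<dots> = (\<Sum>m\<le>Suc n. (Suc n choose m) * line_paths m (x $ i) * ?b (?p x) (Suc n - m))"
    unfolding sum_Suc_choose_convolution[of n "?a (x $ i)" "?b (?p x)"]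
    by (simp add: sum.distrib[symmetric] algebra_simps)
  finally show ?case .
qed

text \<open>The quotient turns \<open>n choose m\<close> into \<open>n + k + 1 choose m + 1\<close>
  up to a factor that does not depend on \<open>m\<close>, so the left side is part of the binomial
  expansion of \<open>(a + 2) ^ (n + k + 1)\<close>.\<close>

lemma sum_choose_fact_quotient_le:
  fixes a :: real
  assumes a: "a > 0"
  shows "(\<Sum>m\<le>n. (n choose m) * (2 ^ m * a ^ (n - m)) * (fact (n - m) / ((real m + 1) * fact (n - m + k))))
    \<le> fact n / fact (n + Suc k) * (a + 2) ^ (n + Suc k) / (2 * a ^ k)"
proof -
  have summand: "(n choose m) * (2 ^ m * a ^ (n - m)) * (fact (n - m) / ((real m + 1) * fact (n - m + k)))
    = fact n / fact (n + Suc k) / (2 * a ^ k) *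
       (real (n + Suc k choose Suc m) * 2 ^ Suc m * a ^ (n + Suc k - Suc m))" if "m \<le> n" for m
  proof -
    have b1: "real (n choose m) = fact n / (fact m * fact (n - m))"
      by (rule binomial_fact[OF that])
    have b2: "real (n + Suc k choose Suc m) = fact (n + Suc k) / (fact (Suc m) * fact (n - m + k))"
      using binomial_fact[of "Suc m" "n + Suc k", where 'a = real] that
      by (simp add: Suc_diff_le add_diff_assoc2 del: binomial_Suc_Suc fact_Suc)
    have e: "n + Suc k - Suc m = n - m + k" using that by simp
    have f: "(fact (Suc m) :: real) = (m + 1) * fact m" by (simp add: algebra_simps)
    define F F' :: real where "F = fact (n + Suc k)" and "F' = fact (n - m + k)"
    have "F > 0" "F' > 0" by (simp_all add: F_def F'_def)
    then show ?thesis
      unfolding b1 b2 e f unfolding F_def[symmetric] F'_def[symmetric]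
      using a by (simp add: power_add) (simp add: algebra_simps)
  qed
  have "(\<Sum>m\<le>n. (n choose m) * (2 ^ m * a ^ (n - m)) * (fact (n - m) / ((real m + 1) * fact (n - m + k))))
    = fact n / fact (n + Suc k) / (2 * a ^ k) *
        (\<Sum>m\<le>n. real (n + Suc k choose Suc m) * 2 ^ Suc m * a ^ (n + Suc k - Suc m))"
    unfolding sum_distrib_left by (intro sum.cong refl, rule summand) simp
  also have "(\<Sum>m\<le>n. real (n + Suc k choose Suc m) * 2 ^ Suc m * a ^ (n + Suc k - Suc m))
      = (\<Sum>m\<in>Suc ` {..n}. real (n + Suc k choose m) * 2 ^ m * a ^ (n + Suc k - m))"
    by (subst sum.reindex) auto
  also have "\<dots> \<le> (\<Sum>m\<le>n + Suc k. real (n + Suc k choose m) * 2 ^ m * a ^ (n + Suc k - m))"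
    using a by (intro sum_mono2) auto
  also have "\<dots> = (a + 2) ^ (n + Suc k)"
    using binomial_ring[of 2 a "n + Suc k"] by (simp add: add.commute)
  finally show ?thesis
    using a by (simp add: divide_simps mult.commute)
qed

text \<open>Adding one coordinate splits a path into a path along that coordinate and a path along the
  others. By Cauchy-Schwarz for the binomial weights, the product of the two one-factor bounds
  sums up to the same bound with one more factor in the denominator.\<close>

lemma paths_along_le:
  fixes I :: "'d::finite set"
  shows "\<exists>c>0::real. \<forall>n x. paths_along I n x \<le> c * real (2 * card I + 1) ^ n * sqrt (fact n / fact (n + card I))"
proof (induction I rule: finite_induct[OF finite])
  case 1
  have "paths_along ({}::'d set) n x \<le> 1" for n x
    by (induction n arbitrary: x) auto
  then show ?case
    by (intro exI[of _ 1]) simp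
next
  case (2 i I)
  from 2(3) obtain c :: real where c: "c > 0"
    and le: "\<And>n x. paths_along I n x \<le> c * real (2 * card I + 1) ^ n * sqrt (fact n / fact (n + card I))"
    by (elim exE conjE) simp
  define a k where "a = real (2 * card I + 1)" and "k = card I"
  have a: "a > 0" by (simp add: a_def)
  \<comment> \<open>The \<open>k + 1\<close> surplus powers of \<open>a + 2\<close> that
    \<open>sum_choose_fact_quotient_le\<close> leaves under the root go into the constant.\<close>
  define C where "C = c * sqrt ((a + 2) ^ Suc k / (2 * a ^ k))"
  have "paths_along (insert i I) n x \<le> C * (a + 2) ^ n * sqrt (fact n / fact (n + Suc k))" for n x
  proof -
    let ?w = "\<lambda>m. (n choose m) * (2 ^ m * a ^ (n - m))"
    let ?q = "\<lambda>m. fact (n - m) / ((real m + 1) * fact (n - m + k)) :: real"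
    have "paths_along (insert i I) n x \<le> (\<Sum>m\<le>n. (n choose m) * (2 ^ m / sqrt (m + 1)) *
        (c * a ^ (n - m) * sqrt (fact (n - m) / fact (n - m + k))))"
      unfolding paths_along_insert[OF 2(2)]
      using c a line_paths_nonneg paths_along_nonneg
      by (intro sum_mono mult_mono line_paths_le le[folded a_def k_def]) auto
    also have "\<dots> = c * (\<Sum>m\<le>n. sqrt (?w m) * sqrt (?w m * ?q m))"
      unfolding sum_distrib_left
    proof (intro sum.cong refl)
      fix m assume "m \<in> {..n}"
      have eq: "sqrt (?w m) * sqrt (?w m * ?q m) = ?w m * sqrt (?q m)"
      proof -
        have root: "sqrt w * sqrt (w * q) = w * sqrt q" if "w \<ge> 0" for w q :: real
          using that by (simp add: real_sqrt_mult mult.assoc[symmetric])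
        show ?thesis by (rule root) (use a in simp)
      qed
      show "(n choose m) * (2 ^ m / sqrt (m + 1)) *
          (c * a ^ (n - m) * sqrt (fact (n - m) / fact (n - m + k))) = c * (sqrt (?w m) * sqrt (?w m * ?q m))"
        unfolding eq by (simp add: real_sqrt_mult real_sqrt_divide add.commute)
    qed
    also have "(\<Sum>m\<le>n. sqrt (?w m) * sqrt (?w m * ?q m))
        \<le> sqrt ((\<Sum>m\<le>n. ?w m) * (\<Sum>m\<le>n. ?w m * ?q m))"
      using Cauchy_Schwarz_ineq_sum[of "\<lambda>m. sqrt (?w m)" "\<lambda>m. sqrt (?w m * ?q m)" "{..n}"] a
      by (intro real_le_rsqrt) simp
    also have "(\<Sum>m\<le>n. ?w m) = (a + 2) ^ n"
      using binomial_ring[of 2 a n] by (simp add: add.commute mult.assoc)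
    also have "sqrt ((a + 2) ^ n * (\<Sum>m\<le>n. ?w m * ?q m)) \<le>
        sqrt ((a + 2) ^ n * (fact n / fact (n + Suc k) * (a + 2) ^ (n + Suc k) / (2 * a ^ k)))"
      using a by (intro real_sqrt_le_mono mult_left_mono sum_choose_fact_quotient_le) auto
    also have "\<dots> = (a + 2) ^ n * sqrt (fact n / fact (n + Suc k)) * sqrt ((a + 2) ^ Suc k / (2 * a ^ k))"
    proof -
      have eq: "(a + 2) ^ n * (fact n / fact (n + Suc k) * (a + 2) ^ (n + Suc k) / (2 * a ^ k))
        = ((a + 2) ^ n)\<^sup>2 * (fact n / fact (n + Suc k)) * ((a + 2) ^ Suc k / (2 * a ^ k))"
        by (simp add: power2_eq_square power_add mult_ac del: fact_Suc)
      show ?thesis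
        unfolding eq real_sqrt_mult using a by (simp del: fact_Suc)
    qed
    finally show ?thesis
      using c by (simp add: C_def mult_ac del: fact_Suc)
  qed
  moreover have "C > 0" using a c by (simp add: C_def)
  moreover have "card (insert i I) = Suc k" "a + 2 = real (2 * card (insert i I) + 1)"
    using 2 by (auto simp: a_def k_def)
  ultimately show ?case by metis
qed

section \<open>The transition operator and its kernels\<close>

lemma sum_sites:
  fixes x :: "int ^ 'd"
  shows "(\<Sum>y\<in>sites x. g y) = (g x :: 'b::comm_monoid_add) + (\<Sum>i\<in>UNIV. g (x + axis i 1) + g (x + axis i (- 1)))"
proof -
  let ?f = "\<lambda>(i, s). x + axis i (s::int)"
  have inj: "inj_on ?f (UNIV \<times> {1, -1})"
    by (auto simp: inj_on_def axis_eq_axis)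
  have notin: "x \<notin> ?f ` (UNIV \<times> {1, -1})"
    by (auto simp: axis_eq_0_iff)
  have "(\<Sum>y\<in>sites x. g y) = g x + (\<Sum>p\<in>UNIV \<times> {1, -1}. g (?f p))"
    unfolding sites_eq by (subst sum.insert[OF _ notin]) (simp_all add: sum.reindex[OF inj])
  also have "(\<Sum>p\<in>UNIV \<times> {1, -1}. g (?f p)) = (\<Sum>i\<in>UNIV. g (x + axis i 1) + g (x + axis i (- 1)))"
    using sum.cartesian_product[of "\<lambda>i s. g (x + axis i s)" "{1, -1}" UNIV] by (simp add: case_prod_beta')
  finally show ?thesis .
qed

definition srw_avg :: "(int ^ 'd \<Rightarrow> real) \<Rightarrow> int ^ 'd \<Rightarrow> real"
  where "srw_avg g x = (\<Sum>y\<in>sites x. g y) / real (2 * CARD('d) + 1)"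

text \<open>The \<open>n\<close>-step transition probability from \<open>x\<close> to 0, and by
  symmetry from 0 to \<open>x\<close>; \<open>walk_hd_eq\<close> identifies it with the law of the
  walk.\<close>

definition srw_kernel :: "nat \<Rightarrow> int ^ 'd \<Rightarrow> real"
  where "srw_kernel n x = paths_along UNIV n x / real (2 * CARD('d) + 1) ^ n"

lemma srw_kernel_0: "srw_kernel 0 x = of_bool (x = 0)"
  by (simp add: srw_kernel_def)

lemma srw_kernel_nonneg: "0 \<le> srw_kernel n x"
  by (simp add: srw_kernel_def paths_along_nonneg)

lemma srw_kernel_Suc: "srw_kernel (Suc n) x = srw_avg (srw_kernel n) x"
proof -
  define K where "K = real (2 * CARD('a) + 1)"
  show ?thesis
    unfolding srw_kernel_def srw_avg_def sum_divide_distrib[symmetric] sum_sites K_def[symmetric]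
    by (simp add: sum_divide_distrib add_divide_distrib mult.commute)
qed

lemma srw_kernel_minus: "srw_kernel n (- x) = srw_kernel n (x :: int ^ 'd)"
proof -
  have "paths_along UNIV n (- x) = paths_along UNIV n x" for x :: "int ^ 'd"
  proof (induction n arbitrary: x)
    case (Suc n)
    have eq: "- x + axis i s = - (x + axis i (- s))" for i s
      by (auto simp: vec_eq_iff axis_def)
    show ?case
      by (simp only: paths_along.simps eq Suc minus_minus add.commute)
  qed simp
  then show ?thesis by (simp add: srw_kernel_def)
qed

text \<open>Averaging moves the centre of the kernel, so the induction runs over all centres
  \<open>a\<close>.\<close>

lemma sum_srw_kernel_le_1:
  fixes A :: "(int ^ 'd) set"
  assumes "finite A"
  shows "(\<Sum>x\<in>A. srw_kernel n (x - a)) \<le> 1"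
  using assms
proof (induction n arbitrary: a)
  case 0
  have "(\<Sum>x\<in>A. srw_kernel 0 (x - a)) = (\<Sum>x\<in>A. if x = a then 1 else 0)"
    by (intro sum.cong) (auto simp: srw_kernel_0)
  then show ?case using 0 by simp
next
  case (Suc n)
  let ?s = "\<lambda>a. \<Sum>x\<in>A. srw_kernel n (x - a)"
  have shift: "x - a + axis i s = x - (a - axis i s)" for x i s
    by simp
  have "(\<Sum>x\<in>A. srw_kernel (Suc n) (x - a))
      = (?s a + (\<Sum>i\<in>UNIV. ?s (a - axis i 1) + ?s (a - axis i (- 1)))) / (2 * CARD('d) + 1)"
    unfolding srw_kernel_Suc srw_avg_def sum_sites sum_divide_distrib[symmetric] sum.distrib
      sum.swap[of _ UNIV A] shift ..
  also have "\<dots> \<le> (1 + (\<Sum>i\<in>(UNIV::'d set). 1 + 1)) / (2 * CARD('d) + 1)"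
    using Suc by (intro divide_right_mono add_mono sum_mono) auto
  also have "\<dots> = 1" by simp
  finally show ?case .
qed

lemma srw_avg_translate: "srw_avg (\<lambda>y. g (y - a)) x = srw_avg g (x - a)"
  by (simp add: srw_avg_def sum_sites algebra_simps)

lemma srw_avg_reflect: "srw_avg (\<lambda>y. g (- y)) x = srw_avg g (- x :: int ^ 'd)"
proof -
  have "- (x + axis i s) = - x + axis i (- s)" for i s
    by (auto simp: vec_eq_iff axis_def)
  then show ?thesis
    by (simp add: srw_avg_def sum_sites add.commute)
qed

lemma srw_avg_sum: "srw_avg (\<lambda>y. \<Sum>j\<in>J. g j y) x = (\<Sum>j\<in>J. srw_avg (g j) x)"
  by (simp add: srw_avg_def sum.swap[of _ J] sum_divide_distrib)

lemma srw_avg_cmult: "srw_avg (\<lambda>y. c * g y) x = c * srw_avg g x"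
  by (simp add: srw_avg_def sum_distrib_left)

lemma srw_avg_affine: "srw_avg (\<lambda>y. 1 + g y / c) x = 1 + srw_avg g (x :: int ^ 'd) / c"
  unfolding srw_avg_def sum.distrib sum_divide_distrib[symmetric]
  by (simp add: card_sites add_divide_distrib mult.commute)

text \<open>Here the dimension enters: \<open>fact n / fact (n + d)\<close> is at most
  \<open>1 / (n + 1) ^ 5\<close>, and the kernel is bounded by its root. A factor
  \<open>n + 1\<close> is kept on the left because both the weights of \<open>green2_tail\<close>
  and the union bound over path positions cost one.\<close>

lemma srw_kernel_le:
  assumes d: "CARD('d) \<ge> 5"
  shows "\<exists>C>0. \<forall>n (x :: int ^ 'd). (real n + 1) * srw_kernel n x \<le> C / ((real n + 1) * sqrt (real n + 1))"
proof -
  obtain c :: real where c: "c > 0"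
    and le: "\<And>n (x :: int ^ 'd). paths_along UNIV n x
      \<le> c * real (2 * CARD('d) + 1) ^ n * sqrt (fact n / fact (n + CARD('d)))"
    using paths_along_le[of "UNIV :: 'd set"] by auto
  have "real (n + 1) * srw_kernel n x \<le> c / (real (n + 1) * sqrt (real (n + 1)))" for n and x :: "int ^ 'd"
  proof -
    have "(real n + 1) ^ 5 * fact n =
        (real n + 1) * ((real n + 1) * ((real n + 1) * ((real n + 1) * ((real n + 1) * fact n))))"
      by (simp add: numeral_eq_Suc mult.assoc)
    also have "\<dots> \<le> (real n + 5) * ((real n + 4) * ((real n + 3) * ((real n + 2) * ((real n + 1) * fact n))))"
      by (intro mult_mono) auto
    also have "\<dots> = fact (n + 5)"
      by (simp add: numeral_eq_Suc add_ac)
    also have "\<dots> \<le> fact (n + CARD('d))"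
      using d by (intro fact_mono) auto
    finally have "fact n / fact (n + CARD('d)) \<le> 1 / (real n + 1) ^ 5"
      by (simp add: field_simps)
    then have "sqrt (fact n / fact (n + CARD('d))) \<le> sqrt (1 / (real n + 1) ^ 5)"
      by (rule real_sqrt_le_mono)
    also have "\<dots> = 1 / ((real n + 1) ^ 2 * sqrt (n + 1))"
    proof -
      have eq: "(real n + 1) ^ 5 = ((real n + 1) ^ 2)\<^sup>2 * (n + 1)"
        by (simp add: numeral_eq_Suc mult_ac)
      show ?thesis unfolding eq real_sqrt_divide real_sqrt_mult real_sqrt_abs by simp
    qed
    finally have root: "sqrt (fact n / fact (n + CARD('d))) \<le> 1 / ((real n + 1) ^ 2 * sqrt (n + 1))" .
    have "srw_kernel n x \<le> c * sqrt (fact n / fact (n + CARD('d)))"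
      using le[of n x] by (simp add: srw_kernel_def field_simps)
    also have "\<dots> \<le> c * (1 / ((real n + 1) ^ 2 * sqrt (n + 1)))"
      using c root by (intro mult_left_mono) auto
    finally have "(n + 1) * srw_kernel n x \<le> (n + 1) * (c * (1 / ((real n + 1) ^ 2 * sqrt (n + 1))))"
      by (intro mult_left_mono) auto
    also have "\<dots> = c / ((n + 1) * sqrt (n + 1))"
      by (simp add: power2_eq_square add.commute)
    finally show ?thesis .
  qed
  then show ?thesis using c by (intro exI[of _ c]) (auto simp: add.commute)
qed

section \<open>Tails of the Green function and of its iterate\<close>

text \<open>Each summand is at most \<open>2 / sqrt (k + n) - 2 / sqrt (k + n + 1)\<close>, and
  these differences telescope.\<close>

lemma tail_three_halves:
  assumes n: "n > 0"
  shows "summable (\<lambda>k. 1 / ((real (k + n) + 1) * sqrt (real (k + n) + 1)))"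
    and "(\<Sum>k. 1 / ((real (k + n) + 1) * sqrt (real (k + n) + 1))) \<le> 2 / sqrt n"
proof -
  let ?q = "\<lambda>k. 1 / ((real (k + n) + 1) * sqrt (real (k + n) + 1))"
  let ?f = "\<lambda>k. 2 / sqrt (real (k + n))"
  have "?f \<longlonglongrightarrow> 0" by real_asymp
  then have sums: "(\<lambda>k. ?f k - ?f (Suc k)) sums (2 / sqrt n)"
    using telescope_sums'[of ?f 0] by simp
  have le: "?q k \<le> ?f k - ?f (Suc k)" for k
  proof -
    define a where "a = real (k + n)"
    have a: "a > 0" using n by (simp add: a_def)
    define r s where "r = sqrt a" and "s = sqrt (a + 1)"
    have rs: "r > 0" "r \<le> s" "r * r = a" "s * s = a + 1"
      using a by (auto simp: r_def s_def)
    have "(s - r) * (s + r) = 1" using rs by (simp add: algebra_simps)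
    moreover have "(s - r) * (s + r) \<le> (s - r) * (2 * s)"
      using rs by (intro mult_left_mono) auto
    ultimately have "1 \<le> (s - r) * (2 * s)" by simp
    then have "r * 1 \<le> s * ((s - r) * (2 * s))"
      using rs by (intro mult_mono) auto
    then have "1 / (s * s * s) \<le> 2 / r - 2 / s"
      using rs(1,2) by (simp add: field_simps)
    then have "1 / ((a + 1) * s) \<le> 2 / r - 2 / s"
      unfolding rs(4) .
    then show ?thesis
      by (simp add: a_def r_def s_def add_ac)
  qed
  show "summable ?q"
    by (rule summable_comparison_test'[OF sums_summable[OF sums], of 0]) (use le in auto)
  then show "suminf ?q \<le> 2 / sqrt n"
    using suminf_le[OF le _ sums_summable[OF sums]] sums_unique[OF sums] by simp
qed

text \<open>For \<open>N = 0\<close> this is the Green function of the walk.\<close>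

definition green_tail :: "nat \<Rightarrow> int ^ 'd \<Rightarrow> real"
  where "green_tail N x = (\<Sum>k. srw_kernel (k + N) x)"

text \<open>The Green function convolved with \<open>green_tail N\<close>: there are
  \<open>k + 1\<close> ways to split \<open>k\<close> into two nonnegative times, whence the
  weight.\<close>

definition green2_tail :: "nat \<Rightarrow> int ^ 'd \<Rightarrow> real"
  where "green2_tail N x = (\<Sum>k. (k + 1) * srw_kernel (k + N) x)"

lemma summable_green2:
  assumes "CARD('d) \<ge> 5"
  shows "summable (\<lambda>k. (real k + 1) * srw_kernel (k + N) (x :: int ^ 'd))"
proof -
  obtain C where C: "C > 0"
    and le: "\<And>n (x :: int ^ 'd). (real n + 1) * srw_kernel n x \<le> C / ((real n + 1) * sqrt (real n + 1))"
    using srw_kernel_le[OF assms] by blast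
  \<comment> \<open>The comparison series needs a positive starting index, so the series is first
    treated from index 1 on.\<close>
  have "summable (\<lambda>k. (real (k + 1) + 1) * srw_kernel (k + 1) x)"
  proof (rule summable_comparison_test'[OF summable_mult[OF tail_three_halves(1)[of 1], of C], of 0])
    fix k
    show "norm ((real (k + 1) + 1) * srw_kernel (k + 1) x) \<le> C * (1 / ((real (k + 1) + 1) * sqrt (real (k + 1) + 1)))"
      using le[of "k + 1" x] srw_kernel_nonneg[of "k + 1" x] by (simp add: abs_mult add_ac)
  qed simp
  then have "summable (\<lambda>k. (real k + 1) * srw_kernel k x)"
    by (subst (asm) summable_iff_shift)
  then have "summable (\<lambda>k. (real (k + N) + 1) * srw_kernel (k + N) x)"
    by (subst summable_iff_shift)
  then show ?thesis
    by (rule summable_comparison_test'[of _ 0])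
      (auto simp: abs_mult srw_kernel_nonneg intro!: mult_right_mono)
qed

lemma summable_green:
  assumes "CARD('d) \<ge> 5"
  shows "summable (\<lambda>k. srw_kernel (k + N) (x :: int ^ 'd))"
proof (rule summable_comparison_test'[OF summable_green2[OF assms, of N x], of 0])
  fix k
  show "norm (srw_kernel (k + N) x) \<le> (real k + 1) * srw_kernel (k + N) x"
    using srw_kernel_nonneg[of "k + N" x] by (simp add: algebra_simps)
qed

lemma green2_tail_le:
  assumes "CARD('d) \<ge> 5"
  shows "\<exists>C>0. \<forall>N>0. \<forall>x :: int ^ 'd. green2_tail N x \<le> C / sqrt N"
proof -
  obtain C where C: "C > 0"
    and le: "\<And>n (x :: int ^ 'd). (real n + 1) * srw_kernel n x \<le> C / ((real n + 1) * sqrt (real n + 1))"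
    using srw_kernel_le[OF assms] by blast
  have "green2_tail N x \<le> 2 * C / sqrt N" if N: "N > 0" for N and x :: "int ^ 'd"
  proof -
    have "green2_tail N x \<le> (\<Sum>k. C * (1 / ((real (k + N) + 1) * sqrt (real (k + N) + 1))))"
      unfolding green2_tail_def
    proof (rule suminf_le)
      fix k
      have "(real k + 1) * srw_kernel (k + N) x \<le> (real (k + N) + 1) * srw_kernel (k + N) x"
        by (intro mult_right_mono srw_kernel_nonneg) auto
      then show "real (k + 1) * srw_kernel (k + N) x \<le> C * (1 / ((real (k + N) + 1) * sqrt (real (k + N) + 1)))"
        using le[of "k + N" x] by (simp add: add_ac)
      show "summable (\<lambda>k. real (k + 1) * srw_kernel (k + N) x)"
        using summable_green2[OF assms, of N x] by (simp add: add.commute)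
      show "summable (\<lambda>k. C * (1 / ((real (k + N) + 1) * sqrt (real (k + N) + 1))))"
        by (rule summable_mult[OF tail_three_halves(1)[OF N]])
    qed
    also have "\<dots> = C * (\<Sum>k. 1 / ((real (k + N) + 1) * sqrt (real (k + N) + 1)))"
      by (rule suminf_mult[OF tail_three_halves(1)[OF N]])
    also have "\<dots> \<le> C * (2 / sqrt N)"
      using C tail_three_halves(2)[OF N] by (intro mult_left_mono) auto
    finally show ?thesis by (simp add: mult.commute)
  qed
  then show ?thesis using C by (intro exI[of _ "2 * C"]) auto
qed

lemma green_tail_nonneg:
  assumes "CARD('d) \<ge> 5"
  shows "0 \<le> green_tail N (x :: int ^ 'd)"
  unfolding green_tail_def by (intro suminf_nonneg summable_green assms srw_kernel_nonneg)

lemma green2_tail_nonneg: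
  assumes "CARD('d) \<ge> 5"
  shows "0 \<le> green2_tail N (x :: int ^ 'd)"
  unfolding green2_tail_def using summable_green2[OF assms, of N x]
  by (intro suminf_nonneg) (auto simp: srw_kernel_nonneg add.commute)

lemma green_tail_split:
  assumes "CARD('d) \<ge> 5"
  shows "green_tail 0 (x :: int ^ 'd) = (\<Sum>n<N. srw_kernel n x) + green_tail N x"
  using suminf_split_initial_segment[OF summable_green[OF assms, of 0 x], of N]
  by (simp add: green_tail_def add.commute)

lemma srw_avg_suminf:
  fixes x :: "int ^ 'd"
  assumes "\<And>y. summable (\<lambda>k. f k y)"
  shows "srw_avg (\<lambda>y. \<Sum>k. f k y) x = (\<Sum>k. srw_avg (f k) x)"
  unfolding srw_avg_def
  using assms by (subst suminf_sum[symmetric]) (auto simp: suminf_divide summable_sum)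

text \<open>Averaging advances every kernel by one step, so the series loses exactly its first
  term.\<close>

lemma srw_avg_green_tail:
  assumes "CARD('d) \<ge> 5"
  shows "srw_avg (green_tail N) x = green_tail N (x :: int ^ 'd) - srw_kernel N x"
proof -
  have "srw_avg (green_tail N) x = (\<Sum>k. srw_kernel (Suc k + N) x)"
    unfolding green_tail_def by (subst srw_avg_suminf[OF summable_green[OF assms]]) (simp add: srw_kernel_Suc)
  then show ?thesis
    unfolding green_tail_def using suminf_split_head[OF summable_green[OF assms, of N x]] by simp
qed

text \<open>Averaging advances the kernels but not the weights, which lowers the weight of the
  kernel of time \<open>k + N\<close> from \<open>k + 1\<close> to \<open>k\<close>. Hence
  \<open>green2_tail N\<close> is a potential of \<open>green_tail N\<close>.\<close>

lemma srw_avg_green2_tail: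
  assumes "CARD('d) \<ge> 5"
  shows "srw_avg (green2_tail N) x = green2_tail N (x :: int ^ 'd) - green_tail N x"
proof -
  have s: "summable (\<lambda>k. (real k + 1) * srw_kernel (k + N) y)" for N and y :: "int ^ 'd"
    by (rule summable_green2[OF assms])
  have s': "summable (\<lambda>k. real k * srw_kernel (k + N) x)"
    using summable_diff[OF s[of N x] summable_green[OF assms, of N x]] by (simp add: algebra_simps)
  have "srw_avg (green2_tail N) x = (\<Sum>k. (real k + 1) * srw_kernel (Suc k + N) x)"
    unfolding green2_tail_def using srw_avg_suminf[OF s[of N]]
    by (simp add: srw_avg_cmult srw_kernel_Suc add.commute)
  also have "\<dots> = (\<Sum>k. real k * srw_kernel (k + N) x)"
    using suminf_split_head[OF s'] by (simp add: add.commute)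
  also have "\<dots> = green2_tail N x - green_tail N x"
    unfolding green2_tail_def green_tail_def
    using suminf_diff[OF s[of N x] summable_green[OF assms, of N x]] by (simp add: algebra_simps)
  finally show ?thesis .
qed

subsection \<open>Exponential bounds for additive functionals\<close>

text \<open>The law of the path up to time \<open>n\<close>, most recent position first; the tail of the list consists of
  the positions at times \<open>0, \<dots>, n - 1\<close>.\<close>

primrec walk_pmf :: "nat \<Rightarrow> (int ^ 'd) list pmf"
  where "walk_pmf 0 = return_pmf [0]"
  | "walk_pmf (Suc n) = bind_pmf (walk_pmf n) (\<lambda>l. map_pmf (\<lambda>y. y # l) (pmf_of_set (sites (hd l))))"

lemma length_walk_pmf: "l \<in> set_pmf (walk_pmf n) \<Longrightarrow> length l = Suc n"
  by (induction n arbitrary: l) auto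

lemma nn_integral_sites:
  fixes g :: "int ^ 'd \<Rightarrow> real"
  assumes "\<And>y. g y \<ge> 0"
  shows "(\<integral>\<^sup>+y. ennreal (g y) \<partial>measure_pmf (pmf_of_set (sites x))) = ennreal (srw_avg g x)"
  using assms
  by (simp add: nn_integral_pmf_of_set[OF sites_nonempty finite_sites] srw_avg_def card_sites sum_ennreal
      divide_ennreal[symmetric] sum_nonneg ennreal_of_nat_eq_real_of_nat del: of_nat_add of_nat_mult)

lemma nn_integral_walk_Suc:
  "(\<integral>\<^sup>+l. f l \<partial>measure_pmf (walk_pmf (Suc n)))
    = (\<integral>\<^sup>+l. (\<integral>\<^sup>+y. f (y # l) \<partial>measure_pmf (pmf_of_set (sites (hd l)))) \<partial>measure_pmf (walk_pmf n))"
  by simp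

text \<open>By the Markov property the last step is absorbed into the function by averaging, hence
  the induction over all \<open>g\<close>.\<close>

lemma nn_integral_walk_hd:
  fixes g :: "int ^ 'd \<Rightarrow> real"
  assumes "\<And>y. g y \<ge> 0"
  shows "(\<integral>\<^sup>+l. ennreal (g (hd l)) \<partial>measure_pmf (walk_pmf n)) = ennreal (((srw_avg ^^ n) g) 0)"
  using assms
proof (induction n arbitrary: g)
  case (Suc n)
  have "srw_avg g y \<ge> 0" for y using Suc(2) by (simp add: srw_avg_def sum_nonneg)
  then show ?case
    unfolding nn_integral_walk_Suc list.sel nn_integral_sites[OF Suc(2)]
    by (subst Suc(1)) (simp_all add: funpow_swap1)
qed simp

lemma srw_avg_funpow_indicator:
  "((srw_avg ^^ n) (\<lambda>y. of_bool (y = z))) x = srw_kernel n (x - z :: int ^ 'd)"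
proof (induction n arbitrary: x)
  case (Suc n)
  then have "(srw_avg ^^ n) (\<lambda>y. of_bool (y = z)) = (\<lambda>y. srw_kernel n (y - z))"
    by blast
  then show ?case
    by (simp add: srw_avg_translate srw_kernel_Suc)
qed (simp add: srw_kernel_0)

lemma walk_hd_eq: "measure_pmf.prob (walk_pmf n) {l. hd l = z} = srw_kernel n (z :: int ^ 'd)"
proof -
  have "ennreal (measure_pmf.prob (walk_pmf n) {l. hd l = z})
      = (\<integral>\<^sup>+l. ennreal (of_bool (hd l = z)) \<partial>measure_pmf (walk_pmf n))"
  proof -
    have "(\<integral>\<^sup>+l. ennreal (of_bool (hd l = z)) \<partial>measure_pmf (walk_pmf n))
        = (\<integral>\<^sup>+l. indicator {l. hd l = z} l \<partial>measure_pmf (walk_pmf n))"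
      by (intro nn_integral_cong) (auto simp: indicator_def)
    then show ?thesis by (simp add: measure_pmf.emeasure_eq_measure)
  qed
  also have "\<dots> = ennreal (srw_kernel n (- z))"
    by (subst nn_integral_walk_hd) (auto simp: srw_avg_funpow_indicator)
  finally show ?thesis
    by (simp add: srw_kernel_minus srw_kernel_nonneg)
qed

text \<open>Since \<open>h \<le> 2\<close>, one has
  \<open>h - v \<le> h (1 - v / 2) \<le> h exp (- v / 2)\<close>. This is the one-step estimate
  behind the supermartingale.\<close>

lemma exp_half_mult_le:
  fixes h v :: real
  assumes "0 \<le> v" "v \<le> 1" "v \<le> h" "h \<le> 2"
  shows "exp (v / 2) * (h - v) \<le> h"
proof -
  have "1 - v / 2 \<le> exp (- (v / 2))"
    using exp_ge_add_one_self[of "- (v / 2)"] by simp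
  then have e: "exp (v / 2) * (1 - v / 2) \<le> 1"
    by (metis exp_gt_zero exp_minus_inverse mult.commute mult_le_cancel_left_pos)
  have "v * h \<le> v * 2" using assms by (intro mult_left_mono) auto
  then have "h - v \<le> h * (1 - v / 2)" by (simp add: algebra_simps)
  then have "exp (v / 2) * (h - v) \<le> exp (v / 2) * (h * (1 - v / 2))"
    by (intro mult_left_mono) auto
  also have "\<dots> = h * (exp (v / 2) * (1 - v / 2))" by simp
  also have "\<dots> \<le> h * 1" using assms e by (intro mult_left_mono) auto
  finally show ?thesis by simp
qed

text \<open>Below level \<open>L\<close> of \<open>W\<close>, the function \<open>1 + W / L\<close> is bounded by \<open>2\<close>; this makes the integrand a
  supermartingale.\<close>

lemma walk_exp_functional_le:
  fixes V W :: "int ^ 'd \<Rightarrow> real"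
  assumes V: "\<And>x. V x \<ge> 0" and W: "\<And>x. W x \<ge> 0" and L: "L > 0"
    and super: "\<And>x. srw_avg W x + V x \<le> W x"
  shows "(\<integral>\<^sup>+l. ennreal (of_bool (\<forall>x\<in>set (tl l). W x \<le> L) * exp ((\<Sum>x\<leftarrow>tl l. V x) / (2 * L)) * (1 + W (hd l) / L))
      \<partial>measure_pmf (walk_pmf n)) \<le> ennreal (1 + W 0 / L)"
proof (induction n)
  case (Suc n)
  let ?F = "\<lambda>l. of_bool (\<forall>x\<in>set (tl l). W x \<le> L) * exp ((\<Sum>x\<leftarrow>tl l. V x) / (2 * L))"
  have "(\<integral>\<^sup>+l. ennreal (?F l * (1 + W (hd l) / L)) \<partial>measure_pmf (walk_pmf (Suc n)))
    = (\<integral>\<^sup>+l. (\<integral>\<^sup>+y. ennreal (?F (y # l) * (1 + W y / L)) \<partial>measure_pmf (pmf_of_set (sites (hd l)))) \<partial>measure_pmf (walk_pmf n))"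
    by simp
  also have "\<dots> \<le> (\<integral>\<^sup>+l. ennreal (?F l * (1 + W (hd l) / L)) \<partial>measure_pmf (walk_pmf n))"
  proof (intro nn_integral_mono_AE, subst AE_measure_pmf_iff, intro ballI)
    fix l :: "(int ^ 'd) list" assume "l \<in> set_pmf (walk_pmf n)"
    then have l: "l = hd l # tl l" using length_walk_pmf[of l n] by (cases l) auto
    define x where "x = hd l"
    let ?v = "V x / L" and ?h = "1 + W x / L"
    \<comment> \<open>Prepending a new position moves the former head \<open>x\<close> into the
      tail. The factor picked up depends on \<open>x\<close> only and leaves the integral over
      \<open>y\<close>.\<close>
    have F': "?F (y # l) = of_bool (W x \<le> L) * exp (?v / 2) * ?F l" for y
      by (subst (1 2) l) (simp add: x_def exp_add add_divide_distrib)
    have "(\<integral>\<^sup>+y. ennreal (?F (y # l) * (1 + W y / L)) \<partial>measure_pmf (pmf_of_set (sites x)))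
      = ennreal (?F (x # l) * (1 + srw_avg W x / L))"
      unfolding F' using L W
      by (subst nn_integral_sites) (simp_all add: srw_avg_cmult srw_avg_affine)
    also have "\<dots> \<le> ennreal (?F l * (1 + W x / L))"
    proof (rule ennreal_leI)
      have "of_bool (W x \<le> L) * exp (?v / 2) * (1 + srw_avg W x / L) \<le> ?h"
      proof (cases "W x \<le> L")
        case True
        have nn: "srw_avg W x \<ge> 0" using W by (simp add: srw_avg_def sum_nonneg)
        have vW: "V x \<le> W x" using super[of x] nn by simp
        have "exp (?v / 2) * (1 + srw_avg W x / L) \<le> exp (?v / 2) * (?h - ?v)"
          using divide_right_mono[OF super[of x], of L] L
          by (intro mult_left_mono) (simp_all add: add_divide_distrib)
        also have "\<dots> \<le> ?h"
          using V[of x] W[of x] vW True L by (intro exp_half_mult_le) (auto simp: field_simps)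
        finally show ?thesis using True by simp
      qed (use W[of x] L in auto)
      then have "?F l * (of_bool (W x \<le> L) * exp (?v / 2) * (1 + srw_avg W x / L)) \<le> ?F l * ?h"
        by (intro mult_left_mono) auto
      then show "?F (x # l) * (1 + srw_avg W x / L) \<le> ?F l * ?h"
        unfolding F' by (simp only: mult_ac)
    qed
    finally show "(\<integral>\<^sup>+y. ennreal (?F (y # l) * (1 + W y / L)) \<partial>measure_pmf (pmf_of_set (sites (hd l))))
      \<le> ennreal (?F l * (1 + W (hd l) / L))"
      unfolding x_def .
  qed
  also note Suc
  finally show ?case .
qed simp

text \<open>Markov's inequality for the exponential functional, whose bound
  \<open>1 + W 0 / L\<close> is at most 2 when \<open>W 0 \<le> L\<close>.\<close>

lemma walk_functional_tail:
  fixes V W :: "int ^ 'd \<Rightarrow> real"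
  assumes V: "\<And>x. V x \<ge> 0" and W: "\<And>x. W x \<ge> 0" and L: "L > 0" and a: "a > 0"
    and super: "\<And>x. srw_avg W x + V x \<le> W x"
  shows "measure_pmf.prob (walk_pmf n) {l. (\<Sum>x\<leftarrow>tl l. V x) \<ge> a \<and> (\<forall>x\<in>set (tl l). W x \<le> L)}
    \<le> 2 * exp (- a / (2 * L))"
    (is "measure_pmf.prob _ ?E \<le> _")
proof (cases "W 0 \<le> L \<and> n > 0")
  case True
  let ?X = "\<lambda>l. of_bool (\<forall>x\<in>set (tl l). W x \<le> L) * exp ((\<Sum>x\<leftarrow>tl l. V x) / (2 * L)) * (1 + W (hd l) / L)"
  have "ennreal (measure_pmf.prob (walk_pmf n) ?E) = (\<integral>\<^sup>+l. indicator ?E l \<partial>measure_pmf (walk_pmf n))"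
    by (simp add: measure_pmf.emeasure_eq_measure)
  also have "\<dots> \<le> (\<integral>\<^sup>+l. ennreal (exp (- a / (2 * L))) * ennreal (?X l) \<partial>measure_pmf (walk_pmf n))"
  proof (intro nn_integral_mono)
    fix l :: "(int ^ 'd) list"
    show "indicator ?E l \<le> ennreal (exp (- a / (2 * L))) * ennreal (?X l)"
    proof (cases "l \<in> ?E")
      case True
      have "1 \<le> exp (- a / (2 * L)) * exp ((\<Sum>x\<leftarrow>tl l. V x) / (2 * L))"
        using True L by (simp add: exp_add[symmetric] diff_divide_distrib[symmetric])
      moreover have "1 \<le> 1 + W (hd l) / L" using W L by simp
      ultimately have "1 * 1 \<le> (exp (- a / (2 * L)) * exp ((\<Sum>x\<leftarrow>tl l. V x) / (2 * L))) * (1 + W (hd l) / L)"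
        by (intro mult_mono) auto
      then show ?thesis
        using True by (simp add: ennreal_mult'[symmetric] mult.assoc)
    qed simp
  qed
  also have "\<dots> \<le> ennreal (exp (- a / (2 * L))) * ennreal (1 + W 0 / L)"
    using walk_exp_functional_le[OF V W L super, of n]
    by (simp add: nn_integral_cmult mult_left_mono)
  also have "\<dots> \<le> ennreal (exp (- a / (2 * L)) * 2)"
    using True L W[of 0] by (simp add: ennreal_mult'[symmetric] ennreal_leI del: ennreal_plus)
  finally show ?thesis
    by (simp add: mult.commute)
next
  \<comment> \<open>If \<open>W 0 > L\<close> and \<open>n > 0\<close>, the starting point already
    violates the constraint; if \<open>n = 0\<close>, the sum is empty and cannot reach
    \<open>a\<close>. Either way the event is null.\<close>
  case False
  have "0 \<in> set l" if "l \<in> set_pmf (walk_pmf n)" for l :: "(int ^ 'd) list" and n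
    using that by (induction n arbitrary: l) auto
  then have "0 \<in> set (tl l)" if "l \<in> set_pmf (walk_pmf n)" "n > 0" for l :: "(int ^ 'd) list"
    using that by (cases n) auto
  moreover have "tl l = []" if "l \<in> set_pmf (walk_pmf n)" "n = 0" for l :: "(int ^ 'd) list"
    using that by simp
  ultimately have "set_pmf (walk_pmf n) \<inter> ?E = {}"
    using False a by (cases "n = 0") fastforce+
  then show ?thesis
    by (simp add: measure_pmf_zero_iff[THEN iffD2])
qed

subsection \<open>Rarely visited sites\<close>

text \<open>Apply \<open>walk_functional_tail\<close> to the two Green tails seen from
  \<open>y\<close>. The bound on \<open>green2_tail\<close> holds everywhere, so the restriction to
  low potential is void.\<close>

lemma walk_green_tail_le:
  assumes d: "CARD('d) \<ge> 5" and L: "L > 0" and a: "a > 0" and le: "\<And>x :: int ^ 'd. green2_tail N x \<le> L"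
  shows "measure_pmf.prob (walk_pmf n) {l. (\<Sum>x\<leftarrow>tl l. green_tail N (y - x :: int ^ 'd)) \<ge> a}
    \<le> 2 * exp (- a / (2 * L))"
proof -
  have "measure_pmf.prob (walk_pmf n) {l. (\<Sum>x\<leftarrow>tl l. green_tail N (y - x)) \<ge> a
      \<and> (\<forall>x\<in>set (tl l). green2_tail N (y - x) \<le> L)} \<le> 2 * exp (- a / (2 * L))"
  proof (rule walk_functional_tail[OF _ _ L a])
    fix x
    have "srw_avg (\<lambda>z. green2_tail N (y - z)) x = srw_avg (green2_tail N) (y - x)"
      using srw_avg_translate[of "\<lambda>z. green2_tail N (- z)" y x]
      by (simp add: srw_avg_reflect)
    then show "srw_avg (\<lambda>z. green2_tail N (y - z)) x + green_tail N (y - x) \<le> green2_tail N (y - x)"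
      by (simp add: srw_avg_green2_tail[OF d])
  qed (use d in \<open>auto intro: green_tail_nonneg green2_tail_nonneg\<close>)
  then show ?thesis by (simp add: le)
qed

section \<open>Truncated visit counts and their potential\<close>

lemma sum_list_eq_sum_count_list:
  fixes f :: "'a \<Rightarrow> real"
  shows "(\<Sum>x\<leftarrow>l. f x) = (\<Sum>z\<in>set l. real (count_list l z) * f z)"
proof (induction l)
  case (Cons a l)
  have "(\<Sum>z\<in>set (a # l). real (count_list (a # l) z) * f z)
      = (\<Sum>z\<in>set (a # l). real (count_list l z) * f z) + (\<Sum>z\<in>set (a # l). if z = a then f z else 0)"
    unfolding sum.distrib[symmetric] by (intro sum.cong) (auto simp: algebra_simps)
  also have "(\<Sum>z\<in>set (a # l). real (count_list l z) * f z) = (\<Sum>z\<in>set l. real (count_list l z) * f z)"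
    by (rule sum.mono_neutral_right) (auto simp: count_list_0_iff)
  finally show ?case using Cons by simp
qed simp

text \<open>The strict inequality complements the \<open>\<ge>\<close> of
  \<open>level_set\<close>.\<close>

definition low_visits :: "real \<Rightarrow> 'a list \<Rightarrow> 'a \<Rightarrow> real"
  where "low_visits \<xi> l z = (if real (count_list l z) < \<xi> then real (count_list l z) else 0)"

definition low_potential :: "real \<Rightarrow> (int ^ 'd) list \<Rightarrow> int ^ 'd \<Rightarrow> real"
  where "low_potential \<xi> l y = (\<Sum>z\<in>set l. low_visits \<xi> l z * green_tail 0 (y - z))"

lemma low_visits_nonneg: "0 \<le> low_visits \<xi> l z"
  by (simp add: low_visits_def)

lemma low_visits_le: "\<xi> \<ge> 0 \<Longrightarrow> low_visits \<xi> l z \<le> \<xi>"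
  by (simp add: low_visits_def)

lemma low_potential_nonneg:
  assumes "CARD('d) \<ge> 5"
  shows "0 \<le> low_potential \<xi> l (y :: int ^ 'd)"
  unfolding low_potential_def
  by (intro sum_nonneg mult_nonneg_nonneg low_visits_nonneg green_tail_nonneg assms)

text \<open>The Green function inverts identity minus averaging: only the point mass at
  \<open>x\<close> survives. This is the supermartingale condition, with equality.\<close>

lemma srw_avg_low_potential:
  assumes "CARD('d) \<ge> 5"
  shows "srw_avg (low_potential \<xi> l) x + low_visits \<xi> l x = low_potential \<xi> l (x :: int ^ 'd)"
proof -
  have "srw_avg (low_potential \<xi> l) x
      = (\<Sum>z\<in>set l. low_visits \<xi> l z * (green_tail 0 (x - z) - srw_kernel 0 (x - z)))"
    unfolding low_potential_def srw_avg_sum srw_avg_cmult srw_avg_translate[of "green_tail 0"]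
      srw_avg_green_tail[OF assms] ..
  also have "\<dots> = low_potential \<xi> l x - (\<Sum>z\<in>set l. if z = x then low_visits \<xi> l z else 0)"
    unfolding low_potential_def sum_subtractf[symmetric]
    by (intro sum.cong) (auto simp: srw_kernel_0 algebra_simps)
  also have "(\<Sum>z\<in>set l. if z = x then low_visits \<xi> l z else 0) = low_visits \<xi> l x"
    by (simp add: low_visits_def)
  finally show ?thesis by simp
qed

text \<open>At times below \<open>N\<close> each truncated count is at most \<xi> and each kernel
  has mass at most 1; from \<open>N\<close> on, truncated counts are replaced by full counts, which
  turns the sum into one along the path.\<close>

lemma low_potential_le:
  assumes d: "CARD('d) \<ge> 5" and \<xi>: "(\<xi>::real) \<ge> 0"
  shows "low_potential \<xi> l y \<le> real N * \<xi> + (\<Sum>x\<leftarrow>l. green_tail N (y - x :: int ^ 'd))"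
proof -
  have "low_potential \<xi> l y = (\<Sum>z\<in>set l. low_visits \<xi> l z * (\<Sum>n<N. srw_kernel n (y - z)))
      + (\<Sum>z\<in>set l. low_visits \<xi> l z * green_tail N (y - z))"
    unfolding low_potential_def green_tail_split[OF d, of _ N] by (simp add: distrib_left sum.distrib)
  also have "\<dots> \<le> (\<Sum>z\<in>set l. \<xi> * (\<Sum>n<N. srw_kernel n (y - z)))
      + (\<Sum>z\<in>set l. count_list l z * green_tail N (y - z))"
    using low_visits_le[OF \<xi>, of l] d
    by (intro add_mono sum_mono mult_right_mono)
      (auto simp: low_visits_def intro!: sum_nonneg srw_kernel_nonneg green_tail_nonneg)
  also have "(\<Sum>z\<in>set l. \<xi> * (\<Sum>n<N. srw_kernel n (y - z))) = \<xi> * (\<Sum>n<N. \<Sum>z\<in>set l. srw_kernel n (z - y))"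
  proof -
    have "srw_kernel n (y - z) = srw_kernel n (z - y)" for n z
      using srw_kernel_minus[of n "z - y"] by simp
    then show ?thesis
      by (simp add: sum_distrib_left[symmetric] sum.swap[of _ "{..<N}"])
  qed
  also have "\<dots> \<le> \<xi> * (\<Sum>n<N. 1)"
    using \<xi> by (intro mult_left_mono sum_mono sum_srw_kernel_le_1) auto
  also have "(\<Sum>z\<in>set l. count_list l z * green_tail N (y - z)) = (\<Sum>x\<leftarrow>l. green_tail N (y - x))"
    by (simp add: sum_list_eq_sum_count_list)
  finally show ?thesis by (simp add: mult.commute)
qed

lemma prob_pair_pmf_le:
  assumes "\<And>x. x \<in> set_pmf p \<Longrightarrow> measure_pmf.prob q {y. P x y} \<le> c"
  shows "measure_pmf.prob (pair_pmf p q) {(x, y). P x y} \<le> c"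
proof -
  obtain x where "x \<in> set_pmf p" using set_pmf_not_empty[of p] by blast
  then have c: "c \<ge> 0" using assms measure_nonneg order.trans by blast
  have "ennreal (measure_pmf.prob (pair_pmf p q) {(x, y). P x y})
      = (\<integral>\<^sup>+z. indicator {(x, y). P x y} z \<partial>pair_pmf p q)"
    by (simp add: measure_pmf.emeasure_eq_measure)
  also have "\<dots> = (\<integral>\<^sup>+x. \<integral>\<^sup>+y. indicator {y. P x y} y \<partial>q \<partial>p)"
    unfolding nn_integral_pair_pmf' by (intro nn_integral_cong) (auto simp: indicator_def)
  also have "\<dots> \<le> (\<integral>\<^sup>+x. ennreal c \<partial>p)"
    by (intro nn_integral_mono_AE) (auto simp: AE_measure_pmf_iff measure_pmf.emeasure_eq_measure assms intro: ennreal_leI)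
  finally show ?thesis using c by simp
qed

lemma prob_pair_pmf_le':
  assumes "\<And>y. y \<in> set_pmf q \<Longrightarrow> measure_pmf.prob p {x. P x y} \<le> c"
  shows "measure_pmf.prob (pair_pmf p q) {(x, y). P x y} \<le> c"
proof -
  have "measure_pmf.prob (pair_pmf p q) {(x, y). P x y} = measure_pmf.prob (pair_pmf q p) {(y, x). P x y}"
    by (subst pair_commute_pmf) (simp add: case_prod_beta' vimage_def)
  also have "\<dots> \<le> c"
    by (rule prob_pair_pmf_le[OF assms])
  finally show ?thesis .
qed

text \<open>Only the first path is truncated; the intersection sum is later covered by adding the
  version with the paths exchanged.\<close>

definition low_intersection :: "real \<Rightarrow> 'a list \<Rightarrow> 'a list \<Rightarrow> real"
  where "low_intersection \<xi> l l' = (\<Sum>z\<in>set l'. low_visits \<xi> l z * real (count_list l' z))"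

text \<open>If the potential of the rarely visited sites is at most \<open>L\<close> along the second walk, the
  exponential bound for that walk applies. Otherwise the potential exceeds \<open>L\<close> at one of its \<open>n\<close>
  positions, where the kernels up to time \<open>N\<close> contribute at most \<open>L / 2\<close>, so the Green
  function after time \<open>N\<close> is large along the first walk.\<close>

lemma low_intersection_tail:
  fixes n N :: nat
  assumes d: "CARD('d) \<ge> 5" and \<xi>: "(\<xi>::real) \<ge> 0" and L: "L > 0" and a: "a > 0" and \<epsilon>: "\<epsilon> > 0"
    and green2: "\<And>x :: int ^ 'd. green2_tail N x \<le> \<epsilon>" and near: "real N * \<xi> \<le> L / 2"
  shows "measure_pmf.prob (pair_pmf (walk_pmf n) (walk_pmf n))
      {(l, l' :: (int ^ 'd) list). low_intersection \<xi> (tl l) (tl l') \<ge> a}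
    \<le> 2 * exp (- a / (2 * L)) + n * (2 * exp (- L / (4 * \<epsilon>)))"
proof -
  let ?P = "measure_pmf.prob (pair_pmf (walk_pmf n) (walk_pmf n)) :: ((int ^ 'd) list \<times> (int ^ 'd) list) set \<Rightarrow> real"
  let ?ok = "\<lambda>l l'. low_intersection \<xi> (tl l) (tl l') \<ge> a
    \<and> (\<forall>y\<in>set (tl l'). low_potential \<xi> (tl l) y \<le> L)"
  let ?bad = "\<lambda>l l'. \<exists>y\<in>set (tl l'). low_potential \<xi> (tl l) y > L"
  have "?P {(l, l' :: (int ^ 'd) list). low_intersection \<xi> (tl l) (tl l') \<ge> a}
      \<le> ?P ({(l, l'). ?ok l l'} \<union> {(l, l'). ?bad l l'})"
    by (intro measure_pmf.finite_measure_mono) (auto simp: not_le)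
  also have "\<dots> \<le> ?P {(l, l'). ?ok l l'} + ?P {(l, l'). ?bad l l'}"
    by (intro measure_Un_le) auto
  also have "?P {(l, l'). ?ok l l'} \<le> 2 * exp (- a / (2 * L))"
  proof (rule prob_pair_pmf_le)
    fix l :: "(int ^ 'd) list"
    have "low_intersection \<xi> (tl l) l' = (\<Sum>z\<leftarrow>l'. low_visits \<xi> (tl l) z)" for l'
      by (simp add: low_intersection_def sum_list_eq_sum_count_list mult.commute)
    moreover have "measure_pmf.prob (walk_pmf n) {l'. (\<Sum>z\<leftarrow>tl l'. low_visits \<xi> (tl l) z) \<ge> a
        \<and> (\<forall>y\<in>set (tl l'). low_potential \<xi> (tl l) y \<le> L)} \<le> 2 * exp (- a / (2 * L))"
      using srw_avg_low_potential[OF d, of \<xi> "tl l"] d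
      by (intro walk_functional_tail L a)
        (simp_all add: low_visits_nonneg low_potential_nonneg)
    ultimately show "measure_pmf.prob (walk_pmf n) {l'. ?ok l l'} \<le> 2 * exp (- a / (2 * L))"
      by simp
  qed
  also have "?P {(l, l'). ?bad l l'} \<le> n * (2 * exp (- L / (4 * \<epsilon>)))"
  proof (rule prob_pair_pmf_le')
    fix l' :: "(int ^ 'd) list" assume l': "l' \<in> set_pmf (walk_pmf n)"
    have point: "measure_pmf.prob (walk_pmf n) {l. low_potential \<xi> (tl l) y > L} \<le> 2 * exp (- L / (4 * \<epsilon>))" for y :: "int ^ 'd"
    proof -
      have "measure_pmf.prob (walk_pmf n) {l. low_potential \<xi> (tl l) y > L}
          \<le> measure_pmf.prob (walk_pmf n) {l. (\<Sum>x\<leftarrow>tl l. green_tail N (y - x)) \<ge> L / 2}"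
      proof (intro measure_pmf.finite_measure_mono subsetI)
        fix l assume "l \<in> {l. low_potential \<xi> (tl l) y > L}"
        then show "l \<in> {l. (\<Sum>x\<leftarrow>tl l. green_tail N (y - x)) \<ge> L / 2}"
          using low_potential_le[OF d \<xi>, of "tl l" y N] near by simp
      qed simp
      also have "\<dots> \<le> 2 * exp (- (L / 2) / (2 * \<epsilon>))"
        using L by (intro walk_green_tail_le d \<epsilon> green2) simp
      finally show ?thesis by simp
    qed
    have "{l. ?bad l l'} = (\<Union>y\<in>set (tl l'). {l. low_potential \<xi> (tl l) y > L})"
      by auto
    then have "measure_pmf.prob (walk_pmf n) {l. ?bad l l'}
        \<le> (\<Sum>y\<in>set (tl l'). measure_pmf.prob (walk_pmf n) {l. low_potential \<xi> (tl l) y > L})"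
      by (auto intro!: measure_pmf.finite_measure_subadditive_finite)
    also have "\<dots> \<le> card (set (tl l')) * (2 * exp (- L / (4 * \<epsilon>)))"
      by (intro sum_bounded_above point)
    also have "\<dots> \<le> n * (2 * exp (- L / (4 * \<epsilon>)))"
      using card_length[of "tl l'"] length_walk_pmf[OF l'] by (intro mult_right_mono) auto
    finally show "measure_pmf.prob (walk_pmf n) {l. ?bad l l'} \<le> n * (2 * exp (- L / (4 * \<epsilon>)))" .
  qed
  finally show ?thesis by simp
qed

text \<open>For a fixed first path, a union bound over its at most \<open>n + 1\<close> sites uses
  up the factor \<open>n + 1\<close> of \<open>srw_kernel_le\<close>. What remains is summable in
  \<open>n\<close>.\<close>

lemma walk_hd_in_set_le:
  assumes d: "CARD('d) \<ge> 5"
  shows "\<exists>C>0. \<forall>n. measure_pmf.prob (pair_pmf (walk_pmf n) (walk_pmf n))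
      {(l, l' :: (int ^ 'd) list). hd l' \<in> set l} \<le> C / ((real n + 1) * sqrt (real n + 1))"
proof -
  obtain C where C: "C > 0"
    and le: "\<And>n (x :: int ^ 'd). (real n + 1) * srw_kernel n x \<le> C / ((real n + 1) * sqrt (real n + 1))"
    using srw_kernel_le[OF d] by blast
  have "measure_pmf.prob (pair_pmf (walk_pmf n) (walk_pmf n)) {(l, l' :: (int ^ 'd) list). hd l' \<in> set l}
      \<le> C / ((real n + 1) * sqrt (real n + 1))" for n
  proof (rule prob_pair_pmf_le)
    fix l :: "(int ^ 'd) list" assume l: "l \<in> set_pmf (walk_pmf n)"
    have "{l' :: (int ^ 'd) list. hd l' \<in> set l} = (\<Union>z\<in>set l. {l'. hd l' = z})"
      by auto
    then have "measure_pmf.prob (walk_pmf n) {l' :: (int ^ 'd) list. hd l' \<in> set l}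
        \<le> (\<Sum>z\<in>set l. measure_pmf.prob (walk_pmf n) {l'. hd l' = z})"
      by (auto intro!: measure_pmf.finite_measure_subadditive_finite)
    also have "\<dots> = (\<Sum>z\<in>set l. srw_kernel n z)"
      by (simp add: walk_hd_eq)
    also have "\<dots> \<le> card (set l) * (C / ((real n + 1) * sqrt (real n + 1)) / (real n + 1))"
      using le[of n] by (intro sum_bounded_above) (simp add: pos_le_divide_eq mult_ac)
    also have "\<dots> \<le> (real n + 1) * (C / ((real n + 1) * sqrt (real n + 1)) / (real n + 1))"
      using card_length[of l] length_walk_pmf[OF l] C by (intro mult_right_mono) auto
    finally show "measure_pmf.prob (walk_pmf n) {l' :: (int ^ 'd) list. hd l' \<in> set l} \<le> C / ((real n + 1) * sqrt (real n + 1))"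
      by simp
  qed
  then show ?thesis using C by blast
qed

subsection \<open>Transfer to the given walks\<close>

text \<open>Reversed so as to agree with the order in \<open>walk_pmf\<close>.\<close>

definition walk_path :: "(nat \<Rightarrow> 'a \<Rightarrow> 'b) \<Rightarrow> nat \<Rightarrow> 'a \<Rightarrow> 'b list"
  where "walk_path S n \<omega> = rev (map (\<lambda>k. S k \<omega>) [0..<Suc n])"

lemma walk_path_Suc: "walk_path S (Suc n) \<omega> = S (Suc n) \<omega> # walk_path S n \<omega>"
  by (simp add: walk_path_def)

lemma tl_walk_path: "tl (walk_path S n \<omega>) = rev (map (\<lambda>k. S k \<omega>) [0..<n])"
  by (simp add: walk_path_def)

lemma hd_walk_path: "hd (walk_path S n \<omega>) = S n \<omega>"
  by (simp add: walk_path_def)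

lemma walk_path_eq_iff:
  assumes "length l = Suc n"
  shows "walk_path S n \<omega> = l \<longleftrightarrow> (\<forall>k\<le>n. S k \<omega> = l ! (n - k))"
proof -
  have "walk_path S n \<omega> = l \<longleftrightarrow> map (\<lambda>k. S k \<omega>) [0..<Suc n] = rev l"
    unfolding walk_path_def by (metis rev_rev_ident)
  also have "\<dots> \<longleftrightarrow> (\<forall>k\<le>n. S k \<omega> = l ! (n - k))"
    using assms by (auto simp: list_eq_iff_nth_eq rev_nth less_Suc_eq_le nth_append simp del: upt_Suc)
  finally show ?thesis .
qed

lemma measurable_walk_path:
  fixes S :: "nat \<Rightarrow> 'a \<Rightarrow> 'b::countable"
  assumes [measurable]: "\<And>k. S k \<in> measurable M (count_space UNIV)"
  shows "walk_path S n \<in> measurable M (count_space UNIV)"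
proof (subst measurable_count_space_eq2_countable, intro conjI ballI)
  fix l :: "'b list"
  show "walk_path S n -` {l} \<inter> space M \<in> sets M"
  proof (cases "length l = Suc n")
    case True
    then have "walk_path S n -` {l} \<inter> space M = {\<omega> \<in> space M. \<forall>k\<in>{..n}. S k \<omega> = l ! (n - k)}"
      by (simp add: vimage_def Int_def walk_path_eq_iff[OF True] conj_commute Ball_def)
    also have "\<dots> \<in> sets M" by measurable
    finally show ?thesis .
  next
    case False
    then have "walk_path S n -` {l} \<inter> space M = {}" by (auto simp: walk_path_def)
    then show ?thesis by simp
  qed
qed auto

lemma pmf_walk_Suc: "pmf (walk_pmf (Suc n)) (y # l) = pmf (walk_pmf n) l * pmf (pmf_of_set (sites (hd l))) y"
proof -
  have "ennreal (pmf (walk_pmf (Suc n)) (y # l))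
    = (\<integral>\<^sup>+m. ennreal (pmf (pmf_of_set (sites (hd l))) y) * indicator {l} m \<partial>measure_pmf (walk_pmf n))"
    unfolding walk_pmf.simps ennreal_pmf_bind
  proof (intro nn_integral_cong)
    fix m
    show "ennreal (pmf (map_pmf (\<lambda>y. y # m) (pmf_of_set (sites (hd m)))) (y # l))
      = ennreal (pmf (pmf_of_set (sites (hd l))) y) * indicator {l} m"
    proof (cases "m = l")
      case True
      then show ?thesis using pmf_map_inj'[of "\<lambda>y. y # l" "pmf_of_set (sites (hd l))" y] by (simp add: inj_def)
    next
      case False
      then have "y # l \<notin> set_pmf (map_pmf (\<lambda>y. y # m) (pmf_of_set (sites (hd m))))"
        by auto
      then show ?thesis using False by (simp add: pmf_eq_0_set_pmf)
    qed
  qed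
  also have "\<dots> = ennreal (pmf (walk_pmf n) l * pmf (pmf_of_set (sites (hd l))) y)"
    by (subst nn_integral_cmult) (simp_all add: emeasure_pmf_single ennreal_mult' mult.commute)
  finally show ?thesis by simp
qed

lemma pmf_walk_length: "length l \<noteq> Suc n \<Longrightarrow> pmf (walk_pmf n) l = 0"
  using length_walk_pmf[of l n] by (auto simp: pmf_eq_0_set_pmf)

text \<open>Induction on \<open>n\<close> by the Markov property, which is assumed for pasts of
  positive probability; for a null past both sides vanish.\<close>

lemma prob_path_eq:
  fixes S :: "nat \<Rightarrow> 'a \<Rightarrow> int ^ 'd"
  assumes S: "aperiodic_srw M 0 S"
  shows "\<P>(\<omega> in M. walk_path S n \<omega> = l) = pmf (walk_pmf n) l"
proof -
  interpret prob_space M using S by (simp add: aperiodic_srw_def)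
  have meas[measurable]: "S k \<in> measurable M (count_space UNIV)" for k
    using S by (simp add: aperiodic_srw_def)
  note [measurable] = measurable_walk_path[OF meas]
  show ?thesis
  proof (induction n arbitrary: l)
    case 0
    have "AE \<omega> in M. S 0 \<omega> = 0" using S by (simp add: aperiodic_srw_def)
    then have "\<P>(\<omega> in M. walk_path S 0 \<omega> = l) = \<P>(\<omega> in M. [0] = l)"
      by (intro prob_eq_AE) (auto simp: walk_path_def elim!: eventually_mono)
    then show ?case
      by (cases "l = [0]") (auto simp: prob_space)
  next
    case (Suc n)
    show ?case
    proof (cases "length l = Suc (Suc n)")
      case False
      then have empty: "{\<omega> \<in> space M. walk_path S (Suc n) \<omega> = l} = {}" by (auto simp: walk_path_def)
      show ?thesis
        unfolding pmf_walk_length[OF False] empty by simp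
    next
      case True
      then obtain y l' where l: "l = y # l'" and l': "length l' = Suc n"
        by (cases l) auto
      define p where "p k = l' ! (n - k)" for k
      have p: "walk_path S n \<omega> = l' \<longleftrightarrow> (\<forall>k\<le>n. S k \<omega> = p k)" for \<omega>
        unfolding p_def by (rule walk_path_eq_iff[OF l'])
      have "p n = hd l'" using l' by (cases l') (auto simp: p_def)
      have "\<P>(\<omega> in M. walk_path S (Suc n) \<omega> = l) = \<P>(\<omega> in M. S (Suc n) \<omega> = y \<and> walk_path S n \<omega> = l')"
        by (simp add: l walk_path_Suc)
      also have "\<dots> = \<P>(\<omega> in M. walk_path S n \<omega> = l') * pmf (pmf_of_set (sites (hd l'))) y"
      proof (cases "\<P>(\<omega> in M. walk_path S n \<omega> = l') > 0")
        case True
        then have "\<P>(\<omega> in M. S (Suc n) \<omega> = y \<bar> \<forall>k\<le>n. S k \<omega> = p k) = pmf (pmf_of_set (sites (p n))) y"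
          using S unfolding aperiodic_srw_def p by blast
        then show ?thesis
          using True unfolding \<open>p n = hd l'\<close> cond_prob_def p[symmetric] by (simp add: field_simps)
      next
        case False
        then have 0: "\<P>(\<omega> in M. walk_path S n \<omega> = l') = 0"
          using measure_nonneg[of M "{\<omega> \<in> space M. walk_path S n \<omega> = l'}"] by linarith
        have "\<P>(\<omega> in M. S (Suc n) \<omega> = y \<and> walk_path S n \<omega> = l') \<le> \<P>(\<omega> in M. walk_path S n \<omega> = l')"
          by (intro finite_measure_mono) auto
        then show ?thesis
          using 0 measure_nonneg[of M "{\<omega> \<in> space M. S (Suc n) \<omega> = y \<and> walk_path S n \<omega> = l'}"] by simp
      qed
      also have "\<dots> = pmf (walk_pmf (Suc n)) l"
        unfolding Suc l pmf_walk_Suc ..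
      finally show ?thesis .
    qed
  qed
qed

text \<open>Independence of the infinite paths passes to their initial pieces, which are measurable
  images. As lists of sites form a countable type, comparing point masses identifies the joint
  law.\<close>

lemma prob_two_paths:
  fixes S S' :: "nat \<Rightarrow> 'a \<Rightarrow> int ^ 'd"
  assumes S: "aperiodic_srw M 0 S" and S': "aperiodic_srw M 0 S'" and ind: "independent_walks M S S'"
  shows "\<P>(\<omega> in M. Q (walk_path S n \<omega>) (walk_path S' n \<omega>))
    = measure_pmf.prob (pair_pmf (walk_pmf n) (walk_pmf n)) {(l, l'). Q l l'}"
    and "{\<omega> \<in> space M. Q (walk_path S n \<omega>) (walk_path S' n \<omega>)} \<in> sets M"
proof -
  interpret prob_space M using S by (simp add: aperiodic_srw_def)
  have meas[measurable]: "walk_path S n \<in> measurable M (count_space UNIV)" "walk_path S' n \<in> measurable M (count_space UNIV)"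
    using S S' by (auto simp: aperiodic_srw_def intro!: measurable_walk_path)
  let ?X = "\<lambda>\<omega>. (walk_path S n \<omega>, walk_path S' n \<omega>)"
  have X[measurable]: "?X \<in> measurable M (count_space UNIV)"
    by (subst measurable_count_space_eq2_countable) (auto simp: vimage_def)
  let ?T = "\<lambda>f :: nat \<Rightarrow> int ^ 'd. walk_path (\<lambda>k f. f k) n f"
  have T: "?T \<in> measurable (\<Pi>\<^sub>M n\<in>UNIV. count_space UNIV) (count_space UNIV)"
    by (intro measurable_walk_path measurable_component_singleton) simp
  have T_comp: "?T \<circ> (\<lambda>\<omega> n. R n \<omega>) = walk_path R n" for R :: "nat \<Rightarrow> 'a \<Rightarrow> int ^ 'd"
    by (simp add: fun_eq_iff walk_path_def)
  have "indep_var (count_space UNIV) (walk_path S n) (count_space UNIV) (walk_path S' n)"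
    using indep_var_compose[OF ind[unfolded independent_walks_def] T T] unfolding T_comp .
  then have prod: "prob (?X -` {(l, l')} \<inter> space M) = \<P>(\<omega> in M. walk_path S n \<omega> = l) * \<P>(\<omega> in M. walk_path S' n \<omega> = l')" for l l'
    using indep_varD[of "count_space UNIV" "walk_path S n" "count_space UNIV" "walk_path S' n" "{l}" "{l'}"]
    by (simp add: vimage_def Int_def conj_commute)
  have "distr M (count_space UNIV) ?X = measure_pmf (pair_pmf (walk_pmf n) (walk_pmf n))"
  proof (rule measure_eqI_countable[where A = UNIV])
    fix q :: "(int ^ 'd) list \<times> (int ^ 'd) list"
    obtain l l' where q: "q = (l, l')" by force
    have "emeasure (distr M (count_space UNIV) ?X) {q} = ennreal (prob (?X -` {(l, l')} \<inter> space M))"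
      by (simp add: emeasure_distr q emeasure_eq_measure)
    also have "\<dots> = emeasure (measure_pmf (pair_pmf (walk_pmf n) (walk_pmf n))) {q}"
      unfolding prod prob_path_eq[OF S] prob_path_eq[OF S'] q emeasure_pmf_single pmf_pair ..
    finally show "emeasure (distr M (count_space UNIV) ?X) {q} = emeasure (measure_pmf (pair_pmf (walk_pmf n) (walk_pmf n))) {q}" .
  qed auto
  then have "measure (distr M (count_space UNIV) ?X) {(l, l'). Q l l'}
      = measure_pmf.prob (pair_pmf (walk_pmf n) (walk_pmf n)) {(l, l'). Q l l'}"
    by simp
  then show "\<P>(\<omega> in M. Q (walk_path S n \<omega>) (walk_path S' n \<omega>))
    = measure_pmf.prob (pair_pmf (walk_pmf n) (walk_pmf n)) {(l, l'). Q l l'}"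
    by (simp add: measure_distr vimage_def Int_def conj_commute)
  show "{\<omega> \<in> space M. Q (walk_path S n \<omega>) (walk_path S' n \<omega>)} \<in> sets M"
    by measurable
qed

section \<open>Local times read off from finite paths\<close>

lemma count_tl_walk_path: "real (count_list (tl (walk_path S n \<omega>)) z) = (\<Sum>k<n. indicator {k. S k \<omega> = z} k)"
  unfolding tl_walk_path by (induction n) (auto simp: indicator_def)

lemma set_tl_walk_path: "set (tl (walk_path S n \<omega>)) = (\<lambda>k. S k \<omega>) ` {..<n}"
  unfolding tl_walk_path by auto

lemma set_walk_path: "set (walk_path S n \<omega>) = (\<lambda>k. S k \<omega>) ` {..n}"
  unfolding walk_path_def by (auto simp: less_Suc_eq_le simp del: upt_Suc)

lemma ennreal_count_tl_walk_path:
  "ennreal (count_list (tl (walk_path S n \<omega>)) z) = (\<Sum>k<n. indicator {k. S k \<omega> = z} k)"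
  unfolding count_tl_walk_path by (subst sum_ennreal[symmetric]) (auto simp: indicator_def ennreal_of_nat_eq_real_of_nat)

lemma count_le_local_time: "ennreal (count_list (tl (walk_path S n \<omega>)) z) \<le> local_time S \<omega> z"
  unfolding ennreal_count_tl_walk_path local_time_def by (rule sum_le_suminf) auto

lemma local_time_eq_count:
  assumes "\<And>k. k \<ge> n \<Longrightarrow> S k \<omega> \<noteq> z"
  shows "local_time S \<omega> z = ennreal (count_list (tl (walk_path S n \<omega>)) z)"
  unfolding ennreal_count_tl_walk_path local_time_def
  using assms by (intro suminf_finite) (auto simp: indicator_def not_less)

lemma local_time_eq_0: "(\<And>k. S k \<omega> \<noteq> z) \<Longrightarrow> local_time S \<omega> z = 0"
  by (simp add: local_time_def)

text \<open>Suppose that from time \<open>n\<close> on neither walk stands on a site the other has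
  visited so far. Then a site visited by both is visited only before \<open>n\<close>, so the
  product of local times is a product of counts. Outside the intersection of the level sets one of
  these counts is below \<xi>.\<close>

lemma infsum_low_local_time_le:
  fixes S S' :: "nat \<Rightarrow> 'a \<Rightarrow> int ^ 'd" and n :: nat and \<omega> :: 'a
  defines "l \<equiv> tl (walk_path S n \<omega>)" and "l' \<equiv> tl (walk_path S' n \<omega>)"
  assumes hit: "\<And>m. m \<ge> n \<Longrightarrow> hd (walk_path S' m \<omega>) \<notin> set (walk_path S m \<omega>)"
    and hit': "\<And>m. m \<ge> n \<Longrightarrow> hd (walk_path S m \<omega>) \<notin> set (walk_path S' m \<omega>)"
  shows "(\<Sum>\<^sub>\<infinity>z\<in>- (level_set S \<omega> \<xi> \<inter> level_set S' \<omega> \<xi>). local_time S \<omega> z * local_time S' \<omega> z)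
    \<le> ennreal (low_intersection \<xi> l l' + low_intersection \<xi> l' l)"
proof -
  let ?B = "- (level_set S \<omega> \<xi> \<inter> level_set S' \<omega> \<xi>)"
  let ?f = "\<lambda>z. local_time S \<omega> z * local_time S' \<omega> z"
  let ?c = "\<lambda>z. real (count_list l z)" and ?c' = "\<lambda>z. real (count_list l' z)"
  let ?F = "set l \<union> set l'"
  have f: "?f z = ennreal (?c z * ?c' z)" for z
  proof (cases "(\<exists>j. S j \<omega> = z) \<and> (\<exists>k. S' k \<omega> = z)")
    case True
    then obtain j k where jk: "S j \<omega> = z" "S' k \<omega> = z" by blast
    have "S i \<omega> \<noteq> z" if "i \<ge> n" for i
    proof
      assume i: "S i \<omega> = z"
      show False
      \<comment> \<open>The later of the two visits happens at time \<open>n\<close> or after, when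
        the other walk has already been at \<open>z\<close>.\<close>
      proof (cases "k \<le> i")
        case True
        then show False using hit'[OF that] i jk(2) \<open>k \<le> i\<close> unfolding hd_walk_path set_walk_path
            by (metis atMost_iff image_eqI linear order.trans)
      next
        case False
        then show False using hit[of k] that i jk(2) \<open>\<not> k \<le> i\<close> unfolding hd_walk_path set_walk_path
            by (metis atMost_iff image_eqI linear order.trans)
      qed
    qed
    moreover have "S' i \<omega> \<noteq> z" if "i \<ge> n" for i
    proof
      assume i: "S' i \<omega> = z"
      show False
      proof (cases "j \<le> i")
        case True
        then show False using hit[OF that] i jk(1) \<open>j \<le> i\<close> unfolding hd_walk_path set_walk_path
            by (metis atMost_iff image_eqI linear order.trans)
      next
        case False
        then show False using hit'[of j] that i jk(1) \<open>\<not> j \<le> i\<close> unfolding hd_walk_path set_walk_path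
            by (metis atMost_iff image_eqI linear order.trans)
      qed
    qed
    ultimately show ?thesis
      using local_time_eq_count[of n S \<omega> z] local_time_eq_count[of n S' \<omega> z]
      by (simp add: l_def l'_def ennreal_mult)
  next
    case False
    then have "z \<notin> set l \<or> z \<notin> set l'"
      by (auto simp: l_def l'_def set_tl_walk_path)
    then have "?c z * ?c' z = 0"
      by (auto simp: count_list_0_iff)
    moreover have "?f z = 0" using False by (auto simp: local_time_eq_0)
    ultimately show ?thesis by (metis ennreal_0)
  qed
  have low: "?c z * ?c' z \<le> low_visits \<xi> l z * ?c' z + low_visits \<xi> l' z * ?c z" if "z \<in> ?B" for z
  proof -
    \<comment> \<open>A count never exceeds the infinite local time, so two counts reaching \<xi>
      would put \<open>z\<close> into both level sets.\<close>
    have "?c z < \<xi> \<or> ?c' z < \<xi>"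
    proof (rule ccontr)
      assume "\<not> (?c z < \<xi> \<or> ?c' z < \<xi>)"
      then have "ennreal \<xi> \<le> ennreal (?c z)" "ennreal \<xi> \<le> ennreal (?c' z)"
        by (auto intro!: ennreal_leI)
      then have "ennreal \<xi> \<le> local_time S \<omega> z" "ennreal \<xi> \<le> local_time S' \<omega> z"
        unfolding l_def l'_def by (auto intro: order.trans[OF _ count_le_local_time])
      then show False using that by (simp add: level_set_def)
    qed
    then show ?thesis
      using low_visits_nonneg[of \<xi> l z] low_visits_nonneg[of \<xi> l' z] by (auto simp: low_visits_def)
  qed
  have "infsum ?f ?B = infsum ?f (?B \<inter> ?F)"
    by (rule infsum_cong_neutral) (auto simp: f count_list_0_iff)
  also have "\<dots> = (\<Sum>z\<in>?B \<inter> ?F. ?f z)"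
    by simp
  also have "\<dots> \<le> (\<Sum>z\<in>?B \<inter> ?F. ennreal (low_visits \<xi> l z * ?c' z + low_visits \<xi> l' z * ?c z))"
    unfolding f using low by (intro sum_mono ennreal_leI) auto
  also have "\<dots> \<le> (\<Sum>z\<in>?F. ennreal (low_visits \<xi> l z * ?c' z + low_visits \<xi> l' z * ?c z))"
    by (intro sum_mono2) auto
  also have "\<dots> = ennreal (\<Sum>z\<in>?F. low_visits \<xi> l z * ?c' z + low_visits \<xi> l' z * ?c z)"
    by (intro sum_ennreal) (auto simp: low_visits_nonneg)
  also have "(\<Sum>z\<in>?F. low_visits \<xi> l z * ?c' z + low_visits \<xi> l' z * ?c z)
      = low_intersection \<xi> l l' + low_intersection \<xi> l' l"
    unfolding sum.distrib low_intersection_def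
    by (intro arg_cong2[where f = "(+)"] sum.mono_neutral_right) (auto simp: count_list_0_iff)
  finally show ?thesis .
qed

section \<open>Choice of parameters and conclusion\<close>

lemma prob_pair_pmf_swap:
  "measure_pmf.prob (pair_pmf p p) {(x, y). P y x} = measure_pmf.prob (pair_pmf p p) {(x, y). P x y}"
  by (subst pair_commute_pmf) (simp add: case_prod_beta' vimage_def)

text \<open>The walks are cut off at time \<open>n \<approx> exp (K * sqrt t)\<close>: this makes a meeting involving a later
  time as unlikely as required, while a union bound over \<open>n\<close> positions is still affordable.\<close>

lemma low_local_time_tail:
  fixes S S' :: "nat \<Rightarrow> 'a \<Rightarrow> int ^ 'd"
  assumes d: "CARD('d) \<ge> 5"
    and S: "aperiodic_srw M 0 S" and S': "aperiodic_srw M 0 S'" and ind: "independent_walks M S S'"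
    and K: "K > 0"
  shows "\<exists>C>0. \<exists>A0. \<forall>A\<ge>A0. \<forall>t>0. \<P>(\<omega> in M.
        (\<Sum>\<^sub>\<infinity>z\<in>- (level_set S \<omega> (sqrt t / A) \<inter> level_set S' \<omega> (sqrt t / A)).
          local_time S \<omega> z * local_time S' \<omega> z) > ennreal t) \<le> C * exp (- K * sqrt t / 2)"
proof -
  interpret prob_space M using S by (simp add: aperiodic_srw_def)
  obtain C1 where C1: "C1 > 0" and hit: "\<And>n. measure_pmf.prob (pair_pmf (walk_pmf n) (walk_pmf n))
      {(l, l' :: (int ^ 'd) list). hd l' \<in> set l} \<le> C1 / ((real n + 1) * sqrt (real n + 1))"
    using walk_hd_in_set_le[OF d] by blast
  obtain C2 where C2: "C2 > 0" and green2: "\<And>N (x :: int ^ 'd). N > 0 \<Longrightarrow> green2_tail N x \<le> C2 / sqrt N"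
    using green2_tail_le[OF d] by blast
  \<comment> \<open>With \<open>L = sqrt t / B\<close> the first exponent in
    \<open>low_intersection_tail\<close> is \<open>(t / 2) / (2 L) = K * sqrt t\<close>. The value
    of \<epsilon> makes the second one \<open>L / (4 \<epsilon>) = 2 * K * sqrt t\<close>, of which
    one half pays for the factor \<open>n\<close>.\<close>
  define B where "B = 4 * K"
  define \<epsilon> where "\<epsilon> = 1 / (8 * B * K)"
  have B: "B > 0" and \<epsilon>: "\<epsilon> > 0" using K by (auto simp: B_def \<epsilon>_def)
  \<comment> \<open>Large enough for \<open>C2 / sqrt N \<le> \<epsilon>\<close>, and chosen before
    \<open>A\<close> and \<open>t\<close>.\<close>
  obtain N :: nat where N: "N > (C2 / \<epsilon>)\<^sup>2" using reals_Archimedean2 by blast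
  have "N > 0" using N by (cases N) auto
  have "C2 / \<epsilon> \<le> sqrt N" using N by (intro real_le_rsqrt) auto
  then have "C2 / sqrt N \<le> \<epsilon>" using \<open>N > 0\<close> \<epsilon> by (simp add: field_simps)
  then have green2': "green2_tail N x \<le> \<epsilon>" for x :: "int ^ 'd"
    using green2[OF \<open>N > 0\<close>, of x] by linarith
  let ?P = "\<lambda>A t. \<P>(\<omega> in M.
        (\<Sum>\<^sub>\<infinity>z\<in>- (level_set S \<omega> (sqrt t / A) \<inter> level_set S' \<omega> (sqrt t / A)).
          local_time S \<omega> z * local_time S' \<omega> z) > ennreal t)"
  \<comment> \<open>The condition on \<open>A\<close> yields \<open>N * \<xi> \<le> L / 2\<close>.
    In the constant, 12 comes from the two orders of \<open>low_intersection\<close> and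
    \<open>4 * C1\<close> from the two kinds of late meeting.\<close>
  have "?P A t \<le> (12 + 4 * C1) * exp (- K * sqrt t / 2)" if A: "A \<ge> 2 * B * N" and t: "t > 0" for A t
  proof -
    define s where "s = sqrt t"
    have s: "s > 0" "s * s = t" using t by (auto simp: s_def)
    have "2 * B * N > 0" using B \<open>N > 0\<close> by simp
    then have "A > 0" using A by linarith
    define \<xi> where "\<xi> = s / A"
    define L where "L = s / B"
    define n where "n = nat \<lceil>exp (K * s)\<rceil>"
    have \<xi>: "\<xi> \<ge> 0" and L: "L > 0" using s \<open>A > 0\<close> B by (auto simp: \<xi>_def L_def)
    have near: "real N * \<xi> \<le> L / 2"
    proof -
      have "real N * \<xi> \<le> real N * (s / (2 * B * N))"
        unfolding \<xi>_def using A s \<open>2 * B * N > 0\<close> by (intro mult_left_mono divide_left_mono) auto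
      also have "\<dots> = L / 2" using \<open>N > 0\<close> by (simp add: L_def)
      finally show ?thesis .
    qed
    have n1: "exp (K * s) \<le> n" and n2: "n \<le> 2 * exp (K * s)"
    proof -
      have "real n = of_int \<lceil>exp (K * s)\<rceil>" unfolding n_def
        using less_ceiling_iff[of 0 "exp (K * s)"] by simp
      moreover have "exp (K * s) \<ge> 1" using K s by simp
      ultimately show "exp (K * s) \<le> n" "n \<le> 2 * exp (K * s)" by linarith+
    qed
    then have "n > 0" using exp_gt_zero[of "K * s"] by (cases n) auto
    let ?E1 = "{\<omega> \<in> space M. low_intersection \<xi> (tl (walk_path S n \<omega>)) (tl (walk_path S' n \<omega>)) \<ge> t / 2}"
    let ?E2 = "{\<omega> \<in> space M. low_intersection \<xi> (tl (walk_path S' n \<omega>)) (tl (walk_path S n \<omega>)) \<ge> t / 2}"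
    let ?H1 = "\<lambda>k. {\<omega> \<in> space M. hd (walk_path S' (k + n) \<omega>) \<in> set (walk_path S (k + n) \<omega>)}"
    let ?H2 = "\<lambda>k. {\<omega> \<in> space M. hd (walk_path S (k + n) \<omega>) \<in> set (walk_path S' (k + n) \<omega>)}"
    have low: "measure_pmf.prob (pair_pmf (walk_pmf n) (walk_pmf n))
        {(l, l' :: (int ^ 'd) list). low_intersection \<xi> (tl l) (tl l') \<ge> t / 2} \<le> 6 * exp (- K * s)"
    proof -
      have e1: "- (t / 2) / (2 * L) = - K * s" using s B by (simp add: L_def B_def field_simps)
      have e2: "- L / (4 * \<epsilon>) = - K * s + - K * s" using B K by (simp add: L_def \<epsilon>_def field_simps)
      have "measure_pmf.prob (pair_pmf (walk_pmf n) (walk_pmf n))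
        {(l, l' :: (int ^ 'd) list). low_intersection \<xi> (tl l) (tl l') \<ge> t / 2}
        \<le> 2 * exp (- K * s) + n * (2 * exp (- K * s + - K * s))"
        using low_intersection_tail[OF d \<xi> L _ \<epsilon> green2' near, of "t / 2" n] t unfolding e1 e2 by simp
      also have "n * (2 * exp (- K * s + - K * s)) \<le> 2 * exp (K * s) * (2 * exp (- K * s + - K * s))"
        using n2 by (intro mult_right_mono) auto
      also have "\<dots> = 4 * exp (- K * s)"
        by (simp add: exp_add[symmetric])
      finally show ?thesis by simp
    qed
    have sqrt_n: "1 / sqrt n \<le> exp (- K * s / 2)"
    proof -
      have "exp (K * s / 2) = sqrt (exp (K * s))"
        by (rule real_sqrt_unique[symmetric]) (auto simp: power2_eq_square exp_add[symmetric])
      also have "\<dots> \<le> sqrt n" using n1 by (rule real_sqrt_le_mono)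
      finally show ?thesis
        using \<open>n > 0\<close> by (simp add: exp_minus field_simps)
    qed
    \<comment> \<open>Summing the meeting bounds from time \<open>n\<close> on gives
      \<open>2 * C1 / sqrt n\<close>; the root is why only the rate \<open>K / 2\<close> is
      reached.\<close>
    have union: "E \<in> sets M \<and> measure M (\<Union>k. H k) \<le> 2 * C1 * exp (- K * s / 2)"
      if "\<And>k. H k \<in> sets M" "\<And>k. measure M (H k) \<le> C1 / ((real (k + n) + 1) * sqrt (real (k + n) + 1))"
        and "E = (\<Union>k. H k)"
      for H E
    proof -
      have sum: "summable (\<lambda>k. C1 * (1 / ((real (k + n) + 1) * sqrt (real (k + n) + 1))))"
        by (rule summable_mult[OF tail_three_halves(1)[OF \<open>n > 0\<close>]])
      have summable: "summable (\<lambda>k. measure M (H k))"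
        by (rule summable_comparison_test'[OF sum, of 0]) (use that(2) in auto)
      have "measure M (\<Union>k. H k) \<le> (\<Sum>k. measure M (H k))"
        using that(1) by (intro finite_measure_subadditive_countably summable) auto
      also have "\<dots> \<le> (\<Sum>k. C1 * (1 / ((real (k + n) + 1) * sqrt (real (k + n) + 1))))"
        using that(2) by (intro suminf_le summable sum) simp
      also have "\<dots> = C1 * (\<Sum>k. 1 / ((real (k + n) + 1) * sqrt (real (k + n) + 1)))"
        by (rule suminf_mult[OF tail_three_halves(1)[OF \<open>n > 0\<close>]])
      also have "\<dots> \<le> C1 * (2 * (1 / sqrt n))"
        using C1 tail_three_halves(2)[OF \<open>n > 0\<close>] by (intro mult_left_mono) auto
      also have "\<dots> \<le> C1 * (2 * exp (- K * s / 2))"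
        using C1 sqrt_n by (intro mult_left_mono) auto
      finally show ?thesis using that by auto
    qed
    have measure_Un4: "measure M ((X \<union> Y) \<union> (Z \<union> W)) \<le> (measure M X + measure M Y) + (measure M Z + measure M W)"
      if "X \<in> sets M" "Y \<in> sets M" "Z \<in> sets M" "W \<in> sets M" for X Y Z W
      using that measure_Un_le[of "X \<union> Y" M "Z \<union> W"] measure_Un_le[of X M Y] measure_Un_le[of Z M W]
      by (smt (verit) sets.Un)
    note two = prob_two_paths[OF S S' ind]
    have E1: "?E1 \<in> sets M" "measure M ?E1 \<le> 6 * exp (- K * s)"
      using low two[of "\<lambda>l l'. low_intersection \<xi> (tl l) (tl l') \<ge> t / 2" n] by simp_all
    have E2: "?E2 \<in> sets M" "measure M ?E2 \<le> 6 * exp (- K * s)"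
      using low two[of "\<lambda>l l'. low_intersection \<xi> (tl l') (tl l) \<ge> t / 2" n]
        prob_pair_pmf_swap[of "walk_pmf n" "\<lambda>l (l' :: (int ^ 'd) list). low_intersection \<xi> (tl l) (tl l') \<ge> t / 2"]
      by simp_all
    have H1: "(\<Union>k. ?H1 k) \<in> sets M \<and> measure M (\<Union>k. ?H1 k) \<le> 2 * C1 * exp (- K * s / 2)"
    proof (rule union)
      fix k
      show "measure M (?H1 k) \<le> C1 / ((real (k + n) + 1) * sqrt (real (k + n) + 1))"
        using two[of "\<lambda>l l'. hd l' \<in> set l" "k + n"] hit[of "k + n"] by simp
    qed (use two[of "\<lambda>l l'. hd l' \<in> set l"] in simp_all)
    have H2: "(\<Union>k. ?H2 k) \<in> sets M \<and> measure M (\<Union>k. ?H2 k) \<le> 2 * C1 * exp (- K * s / 2)"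
    proof (rule union)
      fix k
      show "measure M (?H2 k) \<le> C1 / ((real (k + n) + 1) * sqrt (real (k + n) + 1))"
        using two[of "\<lambda>l l'. hd l \<in> set l'" "k + n"] hit[of "k + n"]
          prob_pair_pmf_swap[of "walk_pmf (k + n)" "\<lambda>l (l' :: (int ^ 'd) list). hd l' \<in> set l"] by simp
    qed (use two[of "\<lambda>l l'. hd l \<in> set l'"] in simp_all)
    \<comment> \<open>Off the four exceptional events \<open>infsum_low_local_time_le\<close>
      applies, and each of its two terms is below \<open>t / 2\<close>.\<close>
    have "?P A t \<le> measure M ((?E1 \<union> ?E2) \<union> ((\<Union>k. ?H1 k) \<union> (\<Union>k. ?H2 k)))"
    proof (rule finite_measure_mono)
      show "(?E1 \<union> ?E2) \<union> ((\<Union>k. ?H1 k) \<union> (\<Union>k. ?H2 k)) \<in> sets M"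
        using E1 E2 H1 H2 by blast
      show "{\<omega> \<in> space M. (\<Sum>\<^sub>\<infinity>z\<in>- (level_set S \<omega> (sqrt t / A) \<inter> level_set S' \<omega> (sqrt t / A)).
          local_time S \<omega> z * local_time S' \<omega> z) > ennreal t}
        \<subseteq> (?E1 \<union> ?E2) \<union> ((\<Union>k. ?H1 k) \<union> (\<Union>k. ?H2 k))"
      proof (intro subsetI, rule ccontr)
        fix \<omega>
        assume \<omega>: "\<omega> \<in> {\<omega> \<in> space M. (\<Sum>\<^sub>\<infinity>z\<in>- (level_set S \<omega> (sqrt t / A) \<inter> level_set S' \<omega> (sqrt t / A)).
          local_time S \<omega> z * local_time S' \<omega> z) > ennreal t}"
          and nin: "\<omega> \<notin> (?E1 \<union> ?E2) \<union> ((\<Union>k. ?H1 k) \<union> (\<Union>k. ?H2 k))"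
        have in_space: "\<omega> \<in> space M"
          using \<omega> by blast
        have "\<omega> \<notin> (\<Union>k. ?H1 k)" "\<omega> \<notin> (\<Union>k. ?H2 k)"
          using nin by (simp_all only: Un_iff de_Morgan_disj simp_thms)
        then have not_hit: "\<omega> \<notin> ?H1 k" "\<omega> \<notin> ?H2 k" for k
          by (simp_all only: UN_iff UNIV_I bex_UNIV not_ex simp_thms)
        have hit1: "hd (walk_path S' m \<omega>) \<notin> set (walk_path S m \<omega>)" if "m \<ge> n" for m
          using not_hit(1)[of "m - n"] in_space that by simp
        have hit2: "hd (walk_path S m \<omega>) \<notin> set (walk_path S' m \<omega>)" if "m \<ge> n" for m
          using not_hit(2)[of "m - n"] in_space that by simp
        have "(\<Sum>\<^sub>\<infinity>z\<in>- (level_set S \<omega> \<xi> \<inter> level_set S' \<omega> \<xi>). local_time S \<omega> z * local_time S' \<omega> z)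
          \<le> ennreal (low_intersection \<xi> (tl (walk_path S n \<omega>)) (tl (walk_path S' n \<omega>))
             + low_intersection \<xi> (tl (walk_path S' n \<omega>)) (tl (walk_path S n \<omega>)))"
          using hit1 hit2 by (rule infsum_low_local_time_le)
        also have "\<dots> \<le> ennreal t"
          using nin \<omega> by (intro ennreal_leI) auto
        finally show False
          using \<omega> by (simp add: \<xi>_def s_def not_le[symmetric])
      qed
    qed
    also have "\<dots> \<le> (measure M ?E1 + measure M ?E2) + (measure M (\<Union>k. ?H1 k) + measure M (\<Union>k. ?H2 k))"
      by (intro measure_Un4 E1(1) E2(1) H1[THEN conjunct1] H2[THEN conjunct1])
    also have "\<dots> \<le> (6 * exp (- K * s) + 6 * exp (- K * s))
        + (2 * C1 * exp (- K * s / 2) + 2 * C1 * exp (- K * s / 2))"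
      by (intro add_mono E1(2) E2(2) H1[THEN conjunct2] H2[THEN conjunct2])
    also have "\<dots> \<le> (12 + 4 * C1) * exp (- K * s / 2)"
    proof -
      have "exp (- K * s) \<le> exp (- K * s / 2)" using K s by simp
      then show ?thesis by (simp add: algebra_simps)
    qed
    finally show ?thesis by (simp add: s_def)
  qed
  then show ?thesis
    using C1 by (intro exI[of _ "12 + 4 * C1"] conjI exI[of _ "2 * B * N"]) auto
qed

theorem proposition1p3:
  fixes M :: "'a measure" and S S' :: "nat \<Rightarrow> 'a \<Rightarrow> int ^ 'd"
  assumes "CARD('d) \<ge> 5"
    and "aperiodic_srw M 0 S"
    and "aperiodic_srw M 0 S'"
    and "independent_walks M S S'"
  shows "Limsup at_top (\<lambda>A::real. Limsup at_top (\<lambda>t::real.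
      ereal (1 / sqrt t) * log_prob \<P>(\<omega> in M.
        (\<Sum>\<^sub>\<infinity>z\<in>- (level_set S \<omega> (sqrt t / A) \<inter> level_set S' \<omega> (sqrt t / A)).
          local_time S \<omega> z * local_time S' \<omega> z) > ennreal t))) = -\<infinity>"
    (is "Limsup at_top (\<lambda>A. Limsup at_top (\<lambda>t. ereal (1 / sqrt t) * log_prob (?P A t))) = _")
proof (rule ereal_bot)
  fix b :: real
  \<comment> \<open>Then \<open>K / 2 = 2 * \<bar>b\<bar> + 2\<close>, so
    \<open>1 - K / 2 \<le> b\<close>; the 1 leaves room for \<open>ln C / sqrt t\<close>.\<close>
  define K where "K = 4 * (\<bar>b\<bar> + 1)"
  have "K > 0" by (simp add: K_def)
  from low_local_time_tail[OF assms this] obtain C A0 where C: "C > 0" and tail: "\<forall>A\<ge>A0. \<forall>t>0. ?P A t \<le> C * exp (- K * sqrt t / 2)"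
    by (elim exE conjE) (rule that)
  have "Limsup at_top (\<lambda>t. ereal (1 / sqrt t) * log_prob (?P A t)) \<le> ereal b" if "A \<ge> A0" for A
  proof (rule Limsup_bounded)
    have "((\<lambda>t. ln C / sqrt t) \<longlongrightarrow> 0) at_top" by real_asymp
    then have "\<forall>\<^sub>F t in at_top. ln C / sqrt t < 1"
      by (rule order_tendstoD) simp
    then show "\<forall>\<^sub>F t in at_top. ereal (1 / sqrt t) * log_prob (?P A t) \<le> ereal b"
      using eventually_gt_at_top[of 0]
    proof eventually_elim
      case (elim t)
      show ?case
      proof (cases "?P A t = 0")
        \<comment> \<open>Here \<open>log_prob\<close> takes the value \<open>-\<infinity>\<close>,
          and the factor \<open>1 / sqrt t\<close> is positive.\<close>
        case True
        then show ?thesis using elim by (simp add: log_prob_def)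
      next
        case False
        then have pos: "?P A t > 0" by (simp only: zero_less_measure_iff not_False_eq_True)
        have "ln (?P A t) \<le> ln (C * exp (- K * sqrt t / 2))"
          using tail[rule_format, OF that elim(2)] pos C by simp
        also have "\<dots> = ln C - K * sqrt t / 2"
          using C by (simp add: ln_mult)
        finally have "1 / sqrt t * ln (?P A t) \<le> 1 / sqrt t * (ln C - K * sqrt t / 2)"
          using elim by (intro mult_left_mono) auto
        also have "\<dots> = ln C / sqrt t - K / 2"
          using elim by (simp add: field_simps)
        also have "\<dots> \<le> b"
        proof -
          have "x - K / 2 \<le> b" if "x < 1" for x
            using that by (cases "b \<ge> 0") (simp_all add: K_def field_simps)
          then show ?thesis using elim(1) .
        qed
        finally show ?thesis using False by (simp add: log_prob_def)
      qed
    qed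
  qed
  then show "Limsup at_top (\<lambda>A. Limsup at_top (\<lambda>t. ereal (1 / sqrt t) * log_prob (?P A t))) \<le> ereal b"
    by (intro Limsup_bounded) (auto simp: eventually_at_top_linorder)
qed

end
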